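(* There exists an optimal solution $(x,p)$ to the original problem in which $p_i(v_{\le i})=v_ix_i(v_{\le i})$ for all $i<k$ and all $v_{\le i}$. That is, the stage utility $v_ix_i(v_{\le i})-p_i(v_{\le i})$ of all types of the buyer is zero on all days before the last day.
   Context: Setting. Fix $k\ge 1$. A seller sells items $1,\dots,k$ to a single buyer over $k$ days. The buyer's value for item $i$ is $v_i\in[\underline v_i,\bar v_i]$ with $0\le\underline v_i<\bar v_i<\infty$, drawn independently of the other values from a distribution with density $f_i$, and learned by the buyer at the beginning of day $i$. Write $v_{\le i}=(v_1,\dots,v_i)$, $v_{<i}=(v_1,\dots,v_{i-1})$; $(v_{\le j},v_i')$ is $v_{\le j}$ with its $i$-th entry replaced by $v_i'$. A mechanism is a sequence of (measurable) functions $x_i(v_{\le i})\in[0,1]$ (allocation probability) and $p_i(v_{\le i})\in\mathbb R$ (payment), $i=1,\dots,k$. Original problem: maximize $\mathbf E[\sum_{i=1}^k p_i(v_{\le i})]$ subject to (periodic incentive compatibility) for all $i$, $v_{\le i}$, $v_i'$: $v_ix_i(v_{\le i})-p_i(v_{\le i})+\mathbf E_{v_{i+1},\dots,v_k}[\sum_{j>i}(v_jx_j(v_{\le j})-p_j(v_{\le j}))]\ \ge\ v_ix_i(v_{<i},v_i')-p_i(v_{<i},v_i')+\mathbf E_{v_{i+1},\dots,v_k}[\sum_{j>i}(v_jx_j(v_{\le j},v_i')-p_j(v_{\le j},v_i'))]$; (ex-post individual rationality) $v_ix_i(v_{\le i})-p_i(v_{\le i})\ge 0$ for all $i$, $v_{\le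 i}$. *)

theory Defs
  imports "HOL-Probability.Probability"
begin

text \<open>
  Items are numbered from 1. A report profile for days \<open>1..i\<close> is an extensional function on
  \<open>{1..i}\<close>, so the rules \<open>x i\<close> and \<open>p i\<close> see exactly \<open>v\<^sub>1, \<dots>, v\<^sub>i\<close>; from a profile covering more
  days they are evaluated via \<^const>\<open>restrict\<close>.
\<close>

definition value_distr ::
    "(nat \<Rightarrow> real) \<Rightarrow> (nat \<Rightarrow> real) \<Rightarrow> (nat \<Rightarrow> real \<Rightarrow> real) \<Rightarrow> nat \<Rightarrow> real measure" where
  "value_distr lo hi f j = density (restrict_space lborel {lo j..hi j}) (\<lambda>v. ennreal (f j v))"

lemma space_value_distr: "space (value_distr lo hi f j) = {lo j..hi j}"
  by (simp add: value_distr_def space_restrict_space)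

text \<open>The value profiles of days \<open>1..i\<close>; independence is built into the product measure.\<close>

definition profile_distr :: "(nat \<Rightarrow> real measure) \<Rightarrow> nat \<Rightarrow> (nat \<Rightarrow> real) measure" where
  "profile_distr D i = Pi\<^sub>M {1..i} D"

lemma space_profile_distr:
  "space (profile_distr (value_distr lo hi f) i) = (\<Pi>\<^sub>E j\<in>{1..i}. {lo j..hi j})"
  by (simp add: profile_distr_def space_PiM space_value_distr)

text \<open>\<open>cont_exp k D i v g\<close> is the expectation of \<open>g (v\<^sub>1, \<dots>, v\<^sub>k)\<close> over \<open>v\<^sub>i\<^sub>+\<^sub>1, \<dots>, v\<^sub>k\<close> only, with
  \<open>v\<^sub>1, \<dots>, v\<^sub>i\<close> fixed.\<close>

definition cont_exp ::
    "nat \<Rightarrow> (nat \<Rightarrow> real measure) \<Rightarrow> nat \<Rightarrow> (nat \<Rightarrow> real) \<Rightarrow> ((nat \<Rightarrow> real) \<Rightarrow> real) \<Rightarrow> real" where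
  "cont_exp k D i v g = (\<integral>w. g (merge {1..i} {i<..k} (v, w)) \<partial>Pi\<^sub>M {i<..k} D)"

text \<open>Besides measurability, a mechanism must have payments for which all the expectations in the
  problem exist; otherwise the Bochner integral would silently be 0. The case \<open>i = 0\<close> concerns the
  expected revenue. Integrability of the utilities follows, as values and allocations are
  bounded.\<close>

definition mechanism ::
    "nat \<Rightarrow> (nat \<Rightarrow> real measure) \<Rightarrow> (nat \<Rightarrow> (nat \<Rightarrow> real) \<Rightarrow> real) \<Rightarrow>
     (nat \<Rightarrow> (nat \<Rightarrow> real) \<Rightarrow> real) \<Rightarrow> bool" where
  "mechanism k D x p \<longleftrightarrow>
     (\<forall>i\<in>{1..k}. x i \<in> borel_measurable (profile_distr D i) \<and>
                 p i \<in> borel_measurable (profile_distr D i) \<and>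
                 (\<forall>v\<in>space (profile_distr D i). 0 \<le> x i v \<and> x i v \<le> 1)) \<and>
     (\<forall>i\<in>{0..k}. \<forall>v\<in>space (profile_distr D i). \<forall>j\<in>{i<..k}.
        integrable (Pi\<^sub>M {i<..k} D) (\<lambda>w. p j (restrict (merge {1..i} {i<..k} (v, w)) {1..j})))"

text \<open>Day-\<open>j\<close> utility of a buyer with true values \<open>v\<close> who has reported \<open>r\<close>.\<close>

definition stage_utility ::
    "(nat \<Rightarrow> (nat \<Rightarrow> real) \<Rightarrow> real) \<Rightarrow> (nat \<Rightarrow> (nat \<Rightarrow> real) \<Rightarrow> real) \<Rightarrow>
     nat \<Rightarrow> (nat \<Rightarrow> real) \<Rightarrow> (nat \<Rightarrow> real) \<Rightarrow> real" where
  "stage_utility x p j v r = v j * x j (restrict r {1..j}) - p j (restrict r {1..j})"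

definition periodic_IC ::
    "nat \<Rightarrow> (nat \<Rightarrow> real measure) \<Rightarrow> (nat \<Rightarrow> (nat \<Rightarrow> real) \<Rightarrow> real) \<Rightarrow>
     (nat \<Rightarrow> (nat \<Rightarrow> real) \<Rightarrow> real) \<Rightarrow> bool" where
  "periodic_IC k D x p \<longleftrightarrow>
     (\<forall>i\<in>{1..k}. \<forall>v\<in>space (profile_distr D i). \<forall>v'\<in>space (D i).
        stage_utility x p i v v
          + cont_exp k D i v (\<lambda>w. \<Sum>j\<in>{i<..k}. stage_utility x p j w w)
        \<ge> stage_utility x p i v (v(i := v'))
          + cont_exp k D i v (\<lambda>w. \<Sum>j\<in>{i<..k}. stage_utility x p j w (w(i := v'))))"

definition ex_post_IR ::
    "nat \<Rightarrow> (nat \<Rightarrow> real measure) \<Rightarrow> (nat \<Rightarrow> (nat \<Rightarrow> real) \<Rightarrow> real) \<Rightarrow>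
     (nat \<Rightarrow> (nat \<Rightarrow> real) \<Rightarrow> real) \<Rightarrow> bool" where
  "ex_post_IR k D x p \<longleftrightarrow>
     (\<forall>i\<in>{1..k}. \<forall>v\<in>space (profile_distr D i). stage_utility x p i v v \<ge> 0)"

definition feasible ::
    "nat \<Rightarrow> (nat \<Rightarrow> real measure) \<Rightarrow> (nat \<Rightarrow> (nat \<Rightarrow> real) \<Rightarrow> real) \<Rightarrow>
     (nat \<Rightarrow> (nat \<Rightarrow> real) \<Rightarrow> real) \<Rightarrow> bool" where
  "feasible k D x p \<longleftrightarrow> mechanism k D x p \<and> periodic_IC k D x p \<and> ex_post_IR k D x p"

definition revenue ::
    "nat \<Rightarrow> (nat \<Rightarrow> real measure) \<Rightarrow> (nat \<Rightarrow> (nat \<Rightarrow> real) \<Rightarrow> real) \<Rightarrow> real" where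
  "revenue k D p = (\<integral>v. (\<Sum>i\<in>{1..k}. p i (restrict v {1..i})) \<partial>profile_distr D k)"

definition optimal ::
    "nat \<Rightarrow> (nat \<Rightarrow> real measure) \<Rightarrow> (nat \<Rightarrow> (nat \<Rightarrow> real) \<Rightarrow> real) \<Rightarrow>
     (nat \<Rightarrow> (nat \<Rightarrow> real) \<Rightarrow> real) \<Rightarrow> bool" where
  "optimal k D x p \<longleftrightarrow>
     feasible k D x p \<and> (\<forall>x' p'. feasible k D x' p' \<longrightarrow> revenue k D p' \<le> revenue k D p)"

end

theory Submission
  imports Defs
begin

text \<open>
  Deferring all utility to the last day changes neither the total payments nor the incentives, so
  only the existence of an optimum needs work. A mechanism is described by the allocations
  \<open>x\<^sub>i\<close> and the expected total utilities \<open>U\<^sub>i\<close> given the first \<open>i\<close> values. The constraints say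
  that \<open>U\<^sub>i\<^sub>-\<^sub>1\<close> is the average of \<open>U\<^sub>i \<ge> 0\<close> over \<open>v\<^sub>i\<close>, and that \<open>x\<^sub>i\<close> is a subgradient of
  \<open>U\<^sub>i\<close> in \<open>v\<^sub>i\<close>. They are convex, and \<open>U\<close> is uniformly bounded along a maximizing sequence.
  Near-minimizers of the \<open>L\<^sup>2\<close> norm among near-maximizers of the revenue form a Cauchy sequence by
  the parallelogram law, so a subsequence converges almost everywhere. Since the constraints are
  imposed at every history, the limit must be repaired on a null set: after the first report that
  leads to a bad history, the repaired mechanism sells nothing and keeps the utility constant.
\<close>

subsection \<open>Convergence from convexity\<close>

text \<open>In terms of the pair (\<open>x\<close>, \<open>U\<close>) the revenue is affine:
  expected welfare minus the utility at the empty history. The obstacle is that incentive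
  compatibility compares all reports of a day, even those of probability zero, while convergence is
  obtained only almost everywhere. Two facts bridge the gap. Since allocations lie between 0 and 1,
  the subgradient inequality makes \<open>U\<close> 1-Lipschitz in the current report, so
  convergence at a dense set of reports spreads to every report. This is why the almost everywhere
  statements refer to uniform distributions and not to the given densities. Moreover, allocations
  need not converge at an exceptional report, because the inequality survives with any cluster value
  in their place. The repair has to wait until the day after the first bad report: on the day
  itself, bad reports are still compared with good ones and must be treated by the same limit.
  Afterwards a constant utility and a zero allocation satisfy the averaging and subgradient
  conditions trivially. The objective is unaffected, as bad histories have probability zero and the
  empty history is good.\<close>

lemma near_minimizers_Cauchy:
  fixes C :: "nat \<Rightarrow> 'm set" and N :: "'m \<Rightarrow> real" and d :: "'m \<Rightarrow> 'm \<Rightarrow> real"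
  assumes decr: "\<And>i j. i \<le> j \<Longrightarrow> C j \<subseteq> C i"
    and ne: "\<And>n. C n \<noteq> {}"
    and N_nonneg: "\<And>a. 0 \<le> N a"
    and N_le: "\<And>a. a \<in> C 0 \<Longrightarrow> N a \<le> B"
    and mid: "\<And>n a b. a \<in> C n \<Longrightarrow> b \<in> C n \<Longrightarrow> \<exists>c\<in>C n. d a b = 2 * N a + 2 * N b - 4 * N c"
  obtains m where "\<And>n. m n \<in> C n"
    and "\<And>e. e > 0 \<Longrightarrow> \<exists>n0. \<forall>i\<ge>n0. \<forall>j\<ge>n0. d (m i) (m j) < e"
proof -
  \<comment> \<open>The infima \<open>J n\<close> increase because the sets shrink, and they are
    bounded by \<open>B\<close>. Their supremum \<open>L\<close> is the value to which the
    \<open>N (m n)\<close> converge.\<close>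
  define J where "J n = Inf (N ` C n)" for n
  have bb: "bdd_below (N ` A)" for A
    using N_nonneg by (auto intro: bdd_belowI2[of _ 0])
  have J_le: "J n \<le> N a" if "a \<in> C n" for n a
    unfolding J_def using that by (intro cInf_lower bb) auto
  have inc: "J i \<le> J j" if "i \<le> j" for i j
    unfolding J_def using ne decr[OF that] by (intro cInf_superset_mono bb) auto
  have JB: "J n \<le> B" for n
  proof -
    obtain a where a: "a \<in> C n" using ne by auto
    then have "a \<in> C 0" using decr[of 0 n] by auto
    then show ?thesis using J_le[OF a] N_le by fastforce
  qed
  have "\<exists>a\<in>C n. N a < J n + 1 / (real n + 1)" for n
  proof -
    have "Inf (N ` C n) < J n + 1 / (real n + 1)" by (simp add: J_def)
    then show ?thesis using ne by (subst (asm) cInf_less_iff) (auto intro: bb)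
  qed
  then obtain m where m: "\<And>n. m n \<in> C n" "\<And>n. N (m n) < J n + 1 / (real n + 1)"
    by metis
  define L where "L = (SUP n. J n)"
  have bdd: "bdd_above (range J)" by (rule bdd_aboveI2) (rule JB)
  have JL: "J n \<le> L" for n
    unfolding L_def by (intro cSUP_upper bdd) auto
  show ?thesis
  proof
    show "m n \<in> C n" for n by (rule m)
    fix e :: real assume e: "e > 0"
    \<comment> \<open>The constant 1/8 comes from the identity in \<open>mid\<close>:
      \<open>N (m i)\<close> and \<open>N (m j)\<close> are below \<open>L + e/8\<close> and
      \<open>N c\<close> is above \<open>L - e/8\<close>, so the distance is below
      \<open>4 * (L + e/8) - 4 * (L - e/8) = e\<close>.\<close>
    have "L - e / 8 < (SUP n. J n)" using e by (simp add: L_def)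
    then obtain n1 where n1: "L - e / 8 < J n1"
      using bdd by (auto simp: less_cSUP_iff)
    obtain n2 where n2: "1 / (real n2 + 1) < e / 8"
      using reals_Archimedean[of "e/8"] e by (auto simp: inverse_eq_divide add.commute)
    define n0 where "n0 = max n1 n2"
    have "d (m i) (m j) < e" if ij: "i \<ge> n0" "j \<ge> n0" for i j
    proof -
      have small: "1 / (real l + 1) < e / 8" if "l \<ge> n0" for l
      proof -
        have "1 / (real l + 1) \<le> 1 / (real n2 + 1)"
          using that by (intro divide_left_mono) (auto simp: n0_def)
        then show ?thesis using n2 by simp
      qed
      have "m i \<in> C n0" "m j \<in> C n0" using m(1) decr ij by blast+
      then obtain c where c: "c \<in> C n0" "d (m i) (m j) = 2 * N (m i) + 2 * N (m j) - 4 * N c"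
        using mid by blast
      have "L - e / 8 < J n0" using n1 inc[of n1 n0] by (simp add: n0_def)
      then show ?thesis
        using c(2) J_le[OF c(1)] m(2)[of i] m(2)[of j] small[OF ij(1)] small[OF ij(2)] JL[of i] JL[of j] e
        by linarith
    qed
    then show "\<exists>n0. \<forall>i\<ge>n0. \<forall>j\<ge>n0. d (m i) (m j) < e" by blast
  qed
qed

text \<open>Induction on the index set: the subsequence found so far is thinned once more for the
  new component, and the earlier components stay Cauchy along it.\<close>

lemma cauchy_L1_AE_cauchy_subseq_finite:
  fixes s :: "'i \<Rightarrow> nat \<Rightarrow> 'a \<Rightarrow> real"
  assumes "finite I"
    and int: "\<And>i n. i \<in> I \<Longrightarrow> integrable M (s i n)"
    and cau: "\<And>i e. i \<in> I \<Longrightarrow> e > 0 \<Longrightarrow> \<exists>N. \<forall>m\<ge>N. \<forall>n\<ge>N. (\<integral>x. \<bar>s i m x - s i n x\<bar> \<partial>M) < e"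
  shows "\<exists>r. strict_mono r \<and> (AE x in M. \<forall>i\<in>I. Cauchy (\<lambda>n. s i (r n) x))"
  using assms
proof (induction I rule: finite_induct)
  case empty
  then show ?case by (auto intro: strict_mono_id)
next
  case (insert i I)
  have "\<exists>r. strict_mono r \<and> (AE x in M. \<forall>i\<in>I. Cauchy (\<lambda>n. s i (r n) x))"
    using insert.prems by (intro insert.IH) auto
  then obtain r where r: "strict_mono r" "AE x in M. \<forall>i\<in>I. Cauchy (\<lambda>n. s i (r n) x)"
    by blast
  have cau: "\<exists>N. \<forall>m\<ge>N. \<forall>n\<ge>N. (\<integral>x. norm (s i (r m) x - s i (r n) x) \<partial>M) < e" if e: "e > 0" for e
  proof -
    obtain N where N: "\<forall>m\<ge>N. \<forall>n\<ge>N. (\<integral>x. \<bar>s i m x - s i n x\<bar> \<partial>M) < e"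
      using insert.prems(2)[OF insertI1 e] by blast
    have "r n \<ge> N" if "n \<ge> N" for n
      using seq_suble[OF r(1), of n] that by linarith
    then show ?thesis using N by (intro exI[of _ N]) simp
  qed
  obtain t where t: "strict_mono t" "AE x in M. Cauchy (\<lambda>n. s i (r (t n)) x)"
    by (rule cauchy_L1_AE_cauchy_subseq[OF insert.prems(1)[OF insertI1] cau])
  have "AE x in M. \<forall>i\<in>insert i I. Cauchy (\<lambda>n. s i ((r \<circ> t) n) x)"
    using r(2) t(2)
  proof eventually_elim
    case (elim x)
    then show ?case
      using Cauchy_subseq_Cauchy[OF _ t(1)] by (auto simp: o_def)
  qed
  then show ?case using strict_mono_o[OF r(1) t(1)] by blast
qed

text \<open>A substitute for weak compactness: points of almost minimal \<open>L\<^sup>2\<close> norm in a decreasing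
  sequence of convex sets form a Cauchy sequence by the parallelogram law.\<close>

lemma convex_decseq_AE_convergent:
  fixes z :: "'m \<Rightarrow> 'i \<Rightarrow> 'a \<Rightarrow> real"
  assumes "prob_space M" and I: "finite I"
    and decr: "\<And>i j. i \<le> j \<Longrightarrow> C j \<subseteq> C i"
    and ne: "\<And>n. C n \<noteq> {}"
    and meas: "\<And>a i. a \<in> C 0 \<Longrightarrow> i \<in> I \<Longrightarrow> z a i \<in> borel_measurable M"
    and bnd: "\<And>a i x. a \<in> C 0 \<Longrightarrow> i \<in> I \<Longrightarrow> x \<in> space M \<Longrightarrow> \<bar>z a i x\<bar> \<le> B"
    and mid: "\<And>n a b. a \<in> C n \<Longrightarrow> b \<in> C n \<Longrightarrow>
      \<exists>c\<in>C n. \<forall>i\<in>I. \<forall>x\<in>space M. z c i x = (z a i x + z b i x) / 2"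
  shows "\<exists>m. (\<forall>n::nat. m n \<in> C n) \<and> (AE x in M. \<forall>i\<in>I. convergent (\<lambda>n. z (m n) i x))"
proof -
  interpret prob_space M by fact
  have sub0: "a \<in> C 0" if "a \<in> C n" for a n using decr[of 0 n] that by auto
  define N where "N a = (\<integral>x. (\<Sum>i\<in>I. (z a i x)\<^sup>2) \<partial>M)" for a
  define d where "d a b = (\<integral>x. (\<Sum>i\<in>I. (z a i x - z b i x)\<^sup>2) \<partial>M)" for a b
  have int_sq: "integrable M (\<lambda>x. (z a i x)\<^sup>2)" if "a \<in> C 0" "i \<in> I" for a i
  proof (rule integrable_const_bound[where B = "B\<^sup>2"])
    show "AE x in M. norm ((z a i x)\<^sup>2) \<le> B\<^sup>2"
      using bnd[OF that] by (intro AE_I2) (simp add: abs_le_square_iff[symmetric] order_trans[OF _ abs_ge_self])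
  qed (use meas[OF that] in measurable)
  have int_z: "integrable M (z a i)" if "a \<in> C 0" "i \<in> I" for a i
    using bnd[OF that] meas[OF that] by (intro integrable_const_bound[where B = B]) auto
  have int_dsq: "integrable M (\<lambda>x. (z a i x - z b i x)\<^sup>2)" if "a \<in> C 0" "b \<in> C 0" "i \<in> I" for a b i
  proof (rule integrable_const_bound[where B = "(2*B)\<^sup>2"])
    show "AE x in M. norm ((z a i x - z b i x)\<^sup>2) \<le> (2*B)\<^sup>2"
    proof (rule AE_I2)
      fix x assume "x \<in> space M"
      then have "\<bar>z a i x - z b i x\<bar> \<le> \<bar>2 * B\<bar>"
        using bnd[of a i x] bnd[of b i x] that by linarith
      then show "norm ((z a i x - z b i x)\<^sup>2) \<le> (2*B)\<^sup>2"
        by (simp add: abs_le_square_iff)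
    qed
  qed (use meas that in measurable)
  have parallelogram: "\<exists>c\<in>C n. d a b = 2 * N a + 2 * N b - 4 * N c" if ab: "a \<in> C n" "b \<in> C n" for n a b
  proof -
    obtain c where c: "c \<in> C n" "\<And>i x. i \<in> I \<Longrightarrow> x \<in> space M \<Longrightarrow> z c i x = (z a i x + z b i x) / 2"
      using mid[OF ab] by blast
    have "d a b = (\<integral>x. 2 * (\<Sum>i\<in>I. (z a i x)\<^sup>2) + 2 * (\<Sum>i\<in>I. (z b i x)\<^sup>2) - 4 * (\<Sum>i\<in>I. (z c i x)\<^sup>2) \<partial>M)"
      unfolding d_def
    proof (rule Bochner_Integration.integral_cong[OF refl])
      fix x assume x: "x \<in> space M"
      have "(z a i x - z b i x)\<^sup>2 = 2 * (z a i x)\<^sup>2 + 2 * (z b i x)\<^sup>2 - 4 * (z c i x)\<^sup>2" if "i \<in> I" for i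
        unfolding c(2)[OF that x] by (simp add: power2_eq_square field_simps)
      then show "(\<Sum>i\<in>I. (z a i x - z b i x)\<^sup>2) = 2 * (\<Sum>i\<in>I. (z a i x)\<^sup>2) + 2 * (\<Sum>i\<in>I. (z b i x)\<^sup>2) - 4 * (\<Sum>i\<in>I. (z c i x)\<^sup>2)"
        by (simp add: sum_distrib_left sum.distrib sum_subtractf)
    qed
    also have "\<dots> = 2 * N a + 2 * N b - 4 * N c"
      unfolding N_def using ab c(1) by (simp add: int_sq sub0)
    finally show ?thesis using c(1) by blast
  qed
  have N_le: "N a \<le> (\<Sum>i\<in>I. B\<^sup>2)" if "a \<in> C 0" for a
  proof -
    have "N a \<le> (\<integral>x. (\<Sum>i\<in>I. B\<^sup>2) \<partial>M)"
      unfolding N_def using that bnd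
      by (intro integral_mono Bochner_Integration.integrable_sum int_sq sum_mono)
         (auto simp: abs_le_square_iff[symmetric] intro: order_trans[OF _ abs_ge_self])
    then show ?thesis by (simp add: prob_space)
  qed
  have N_nonneg: "0 \<le> N a" for a
    unfolding N_def by (rule Bochner_Integration.integral_nonneg) (simp add: sum_nonneg)
  obtain m where m: "\<And>n. m n \<in> C n"
    and d_small: "\<And>e. e > 0 \<Longrightarrow> \<exists>n0. \<forall>i\<ge>n0. \<forall>j\<ge>n0. d (m i) (m j) < e"
    by (rule near_minimizers_Cauchy[of C N "\<Sum>i\<in>I. B\<^sup>2" d, OF decr ne N_nonneg N_le parallelogram])
       metis+
  have m0: "m n \<in> C 0" for n using m sub0 by blast
  have cau: "\<exists>n0. \<forall>p\<ge>n0. \<forall>q\<ge>n0. (\<integral>x. \<bar>z (m p) i x - z (m q) i x\<bar> \<partial>M) < e" if i: "i \<in> I" and e: "e > 0" for i e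
  proof -
    obtain n0 where n0: "\<And>p q. p \<ge> n0 \<Longrightarrow> q \<ge> n0 \<Longrightarrow> d (m p) (m q) < e\<^sup>2"
      using d_small[of "e\<^sup>2"] e by auto
    have "(\<integral>x. \<bar>z (m p) i x - z (m q) i x\<bar> \<partial>M) < e" if pq: "p \<ge> n0" "q \<ge> n0" for p q
    proof -
      let ?D = "\<lambda>x. z (m p) i x - z (m q) i x"
      \<comment> \<open>A weighted AM-GM inequality passes from L2 to L1 distance. A squared L2
        distance below the square of \<open>e\<close> leaves less than \<open>e/2\<close> for the
        second term, which explains the threshold for \<open>n0\<close>.\<close>
      have amgm: "\<bar>t\<bar> \<le> e / 2 + t\<^sup>2 / (2 * e)" for t :: real
      proof -
        have "0 \<le> (e - \<bar>t\<bar>)\<^sup>2" by simp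
        then have "2 * e * \<bar>t\<bar> \<le> e\<^sup>2 + t\<^sup>2" by (simp add: power2_diff)
        then show ?thesis using e by (simp add: field_simps power2_eq_square)
      qed
      have "(\<integral>x. \<bar>?D x\<bar> \<partial>M) \<le> (\<integral>x. e / 2 + (?D x)\<^sup>2 / (2 * e) \<partial>M)"
        using int_z[OF m0 i] int_dsq[OF m0 m0 i] amgm by (intro integral_mono) auto
      also have "\<dots> = e / 2 + (\<integral>x. (?D x)\<^sup>2 \<partial>M) / (2 * e)"
        using int_dsq[OF m0 m0 i] by (simp add: prob_space)
      also have "(\<integral>x. (?D x)\<^sup>2 \<partial>M) \<le> d (m p) (m q)"
        unfolding d_def using int_dsq[OF m0 m0] I i
        by (intro integral_mono member_le_sum Bochner_Integration.integrable_sum) auto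
      then have "e / 2 + (\<integral>x. (?D x)\<^sup>2 \<partial>M) / (2 * e) \<le> e / 2 + d (m p) (m q) / (2 * e)"
        using e by (intro add_left_mono divide_right_mono) auto
      also have "\<dots> < e / 2 + e\<^sup>2 / (2 * e)"
        using n0[OF pq] e by (intro add_strict_left_mono divide_strict_right_mono) auto
      also have "\<dots> = e" using e by (simp add: power2_eq_square)
      finally show ?thesis .
    qed
    then show ?thesis by blast
  qed
  have "\<exists>r. strict_mono r \<and> (AE x in M. \<forall>i\<in>I. Cauchy (\<lambda>n. z (m (r n)) i x))"
    by (rule cauchy_L1_AE_cauchy_subseq_finite[OF I int_z[OF m0] cau])
  then obtain r where r: "strict_mono r" "AE x in M. \<forall>i\<in>I. Cauchy (\<lambda>n. z (m (r n)) i x)"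
    by blast
  show ?thesis
  proof (intro exI conjI allI)
    show "m (r n) \<in> C n" for n
      using m[of "r n"] decr[OF seq_suble[OF r(1), of n]] by blast
    show "AE x in M. \<forall>i\<in>I. convergent (\<lambda>n. z (m (r n)) i x)"
      using r(2) by (simp add: Cauchy_convergent_iff)
  qed
qed

text \<open>The limit inferior is a cluster point, so it inherits affine inequalities whose other terms
  converge.\<close>

definition real_liminf :: "(nat \<Rightarrow> real) \<Rightarrow> real" where
  "real_liminf a = real_of_ereal (liminf (\<lambda>n. ereal (a n)))"

text \<open>The bounds keep the extended limit inferior finite, so its conversion to a real number
  does not fall back on a default value.\<close>

lemma real_liminf_cluster:
  assumes "\<And>n. 0 \<le> a n" "\<And>n. a n \<le> B"
  obtains r where "strict_mono r" "(\<lambda>n. a (r n)) \<longlonglongrightarrow> real_liminf a"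
proof -
  obtain r where r: "strict_mono r" "((\<lambda>n. ereal (a n)) \<circ> r) \<longlonglongrightarrow> liminf (\<lambda>n. ereal (a n))"
    using liminf_subseq_lim by blast
  have "liminf (\<lambda>n. ereal (a n)) \<ge> 0"
    by (rule Liminf_bounded) (simp add: assms)
  moreover have "liminf (\<lambda>n. ereal (a n)) \<le> ereal B"
    using assms by (intro order_trans[OF Liminf_le_Limsup] Limsup_bounded) auto
  ultimately have "ereal (real_liminf a) = liminf (\<lambda>n. ereal (a n))"
    unfolding real_liminf_def by (intro ereal_real') auto
  then have "(\<lambda>n. ereal (a (r n))) \<longlonglongrightarrow> ereal (real_liminf a)" using r(2) by (simp add: o_def)
  then show ?thesis using that r(1) by (simp add: o_def)
qed

lemma real_liminf_eq: "a \<longlonglongrightarrow> l \<Longrightarrow> real_liminf a = l"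
  using lim_imp_Liminf[OF sequentially_bot, of "\<lambda>n. ereal (a n)" "ereal l"]
  by (simp add: real_liminf_def)

lemma borel_measurable_real_liminf:
  assumes "\<And>n. (\<lambda>x. a n x) \<in> borel_measurable M"
  shows "(\<lambda>x. real_liminf (\<lambda>n. a n x)) \<in> borel_measurable M"
  unfolding real_liminf_def using assms by measurable

text \<open>Three errors of size \<open>e/3\<close>: two Lipschitz errors between \<open>t\<close>
  and a nearby point of convergence, and one Cauchy error at that point.\<close>

lemma convergent_of_dense_equi_Lipschitz:
  fixes u :: "nat \<Rightarrow> real \<Rightarrow> real"
  assumes lip: "\<And>n s t. s \<in> S \<Longrightarrow> t \<in> S \<Longrightarrow> \<bar>u n s - u n t\<bar> \<le> \<bar>s - t\<bar>"
    and dense: "\<And>e. e > 0 \<Longrightarrow> \<exists>s\<in>S. \<bar>s - t\<bar> < e \<and> convergent (\<lambda>n. u n s)"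
    and t: "t \<in> S"
  shows "convergent (\<lambda>n. u n t)"
  unfolding Cauchy_convergent_iff[symmetric]
proof (rule metric_CauchyI)
  fix e :: real assume e: "e > 0"
  obtain s where s: "s \<in> S" "\<bar>s - t\<bar> < e / 3" "convergent (\<lambda>n. u n s)"
    using dense[of "e/3"] e by auto
  obtain N where N: "\<And>m n. m \<ge> N \<Longrightarrow> n \<ge> N \<Longrightarrow> \<bar>u m s - u n s\<bar> < e / 3"
    using metric_CauchyD[of "\<lambda>n. u n s" "e/3"] s(3) e by (auto simp: dist_real_def Cauchy_convergent_iff)
  have "dist (u m t) (u n t) < e" if "m \<ge> N" "n \<ge> N" for m n
    using N[OF that] lip[OF s(1) t, of m] lip[OF s(1) t, of n] s(2) unfolding dist_real_def by linarith
  then show "\<exists>M. \<forall>m\<ge>M. \<forall>n\<ge>M. dist (u m t) (u n t) < e" by blast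
qed

text \<open>The measure of the exceptional section depends measurably on \<open>x\<close>, and the
  predicate says that it vanishes. This is what makes iterated almost everywhere quantifiers over
  future reports measurable.\<close>

lemma (in sigma_finite_measure) measurable_pred_AE:
  assumes [measurable]: "Measurable.pred (N \<Otimes>\<^sub>M M) (\<lambda>(x, y). P x y)"
  shows "Measurable.pred N (\<lambda>x. AE y in M. P x y)"
proof -
  have "(AE y in M. P x y) \<longleftrightarrow> emeasure M (Pair x -` {p \<in> space (N \<Otimes>\<^sub>M M). \<not> P (fst p) (snd p)}) = 0"
    if x: "x \<in> space N" for x
  proof -
    have eq: "Pair x -` {p \<in> space (N \<Otimes>\<^sub>M M). \<not> P (fst p) (snd p)} = {y \<in> space M. \<not> P x y}"
      using x by (auto simp: space_pair_measure)
    have "{y \<in> space M. \<not> P x y} \<in> sets M" unfolding eq[symmetric] by measurable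
    then show ?thesis unfolding eq by (subst AE_iff_measurable) auto
  qed
  then have "Measurable.pred N (\<lambda>x. AE y in M. P x y) \<longleftrightarrow>
      Measurable.pred N (\<lambda>x. emeasure M (Pair x -` {p \<in> space (N \<Otimes>\<^sub>M M). \<not> P (fst p) (snd p)}) = 0)"
    by (rule measurable_cong)
  moreover have "(\<lambda>x. emeasure M (Pair x -` {p \<in> space (N \<Otimes>\<^sub>M M). \<not> P (fst p) (snd p)})) \<in> borel_measurable N"
    using assms by (intro measurable_emeasure_Pair) (simp add: case_prod_beta)
  ultimately show ?thesis by simp
qed

subsection \<open>Utility processes\<close>

text \<open>Fubini for null sets, with the last coordinate as the inner quantifier. This matches the
  order of events: the history is fixed before the next value is drawn.\<close>

lemma AE_PiM_atLeastAtMost_Suc_iff: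
  fixes M :: "nat \<Rightarrow> 'a measure"
  assumes prob: "\<And>j. prob_space (M j)"
    and predP: "Measurable.pred (Pi\<^sub>M {1..Suc i} M) P"
  shows "(AE v in Pi\<^sub>M {1..Suc i} M. P v) \<longleftrightarrow>
    (AE h in Pi\<^sub>M {1..i} M. AE y in M (Suc i). P (h(Suc i := y)))"
proof -
  interpret product_prob_space M "{1..i}"
    by (simp add: product_prob_space_def product_prob_space_axioms_def product_sigma_finite_def
        prob prob_space_imp_sigma_finite)
  interpret Y: prob_space "M (Suc i)" by (rule prob)
  interpret P: pair_sigma_finite "M (Suc i)" "Pi\<^sub>M {1..i} M" ..
  have ins: "insert (Suc i) {1..i} = {1..Suc i}" by auto
  let ?h = "\<lambda>(y, h). h(Suc i := y)"
  have h: "?h \<in> M (Suc i) \<Otimes>\<^sub>M Pi\<^sub>M {1..i} M \<rightarrow>\<^sub>M Pi\<^sub>M {1..Suc i} M"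
    unfolding ins[symmetric] by measurable
  have d: "distr (M (Suc i) \<Otimes>\<^sub>M Pi\<^sub>M {1..i} M) (Pi\<^sub>M {1..Suc i} M) ?h = Pi\<^sub>M {1..Suc i} M"
    using distr_pair_PiM_eq_PiM[of "{1..i}" M "Suc i"] prob unfolding ins by simp
  have Ph: "Measurable.pred (M (Suc i) \<Otimes>\<^sub>M Pi\<^sub>M {1..i} M) (\<lambda>q. P (?h q))"
    by (rule measurable_compose[OF h predP])
  then have Ph': "{q \<in> space (M (Suc i) \<Otimes>\<^sub>M Pi\<^sub>M {1..i} M). P ((snd q)(Suc i := fst q))} \<in> sets (M (Suc i) \<Otimes>\<^sub>M Pi\<^sub>M {1..i} M)"
    by (simp add: pred_def case_prod_beta)
  have "(AE v in Pi\<^sub>M {1..Suc i} M. P v) \<longleftrightarrow> (AE v in distr (M (Suc i) \<Otimes>\<^sub>M Pi\<^sub>M {1..i} M) (Pi\<^sub>M {1..Suc i} M) ?h. P v)"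
    unfolding d ..
  also have "\<dots> \<longleftrightarrow> (AE q in M (Suc i) \<Otimes>\<^sub>M Pi\<^sub>M {1..i} M. P ((snd q)(Suc i := fst q)))"
    using AE_distr_iff[OF h predP[unfolded pred_def]] by (simp add: case_prod_beta)
  also have "\<dots> \<longleftrightarrow> (AE y in M (Suc i). AE h in Pi\<^sub>M {1..i} M. P (h(Suc i := y)))"
    by (rule P.AE_pair_iff[OF Ph', symmetric])
  also have "\<dots> \<longleftrightarrow> (AE h in Pi\<^sub>M {1..i} M. AE y in M (Suc i). P (h(Suc i := y)))"
    by (rule P.AE_commute[OF Ph'])
  finally show ?thesis .
qed

text \<open>\<open>Q\<close> is a reference measure whose sets of full measure are dense. The value distributions \<open>D\<close>
  need not have this property, as their densities may vanish on intervals.\<close>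

locale sequential_sale =
  fixes k :: nat and lo hi :: "nat \<Rightarrow> real" and D Q :: "nat \<Rightarrow> real measure"
  assumes prob_D: "\<And>j. prob_space (D j)" and prob_Q: "\<And>j. prob_space (Q j)"
    and sets_D: "\<And>j. sets (D j) = sets (restrict_space borel {lo j..hi j})"
    and sets_Q: "\<And>j. sets (Q j) = sets (restrict_space borel {lo j..hi j})"
    and lo_nonneg: "\<And>j. 0 \<le> lo j" and lo_less_hi: "\<And>j. lo j < hi j"
    and AE_Q_D: "\<And>j P. AE y in Q j. P y \<Longrightarrow> AE y in D j. P y"
    and dense_Q: "\<And>j P a b. lo j \<le> a \<Longrightarrow> a < b \<Longrightarrow> b \<le> hi j \<Longrightarrow> AE y in Q j. P y \<Longrightarrow> \<exists>y. a < y \<and> y < b \<and> P y"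
begin

section \<open>Histories, their extension by one report, and their splicing with future
  values\<close>

abbreviation H :: "nat \<Rightarrow> (nat \<Rightarrow> real) measure" where "H i \<equiv> profile_distr D i"

text \<open>The only history of length 0, namely the extensional function on the empty set.\<close>

abbreviation root :: "nat \<Rightarrow> real" where "root \<equiv> \<lambda>_. undefined"

lemma space_D: "space (D j) = {lo j..hi j}"
  using sets_eq_imp_space_eq[OF sets_D[of j]] by (simp add: space_restrict_space)

lemma space_Q: "space (Q j) = {lo j..hi j}"
  using sets_eq_imp_space_eq[OF sets_Q[of j]] by (simp add: space_restrict_space)

lemma measurable_D_borel: "A \<in> borel_measurable borel \<Longrightarrow> A \<in> borel_measurable (D j)"
  by (subst measurable_cong_sets[OF sets_D refl]) (rule measurable_restrict_space1)

lemma space_H: "space (H i) = (\<Pi>\<^sub>E j\<in>{1..i}. {lo j..hi j})"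
  by (simp add: profile_distr_def space_PiM space_D)

lemma prob_space_PiM_D: "prob_space (Pi\<^sub>M I D)"
  by (intro prob_space_PiM prob_D)

lemma prob_space_H: "prob_space (H i)"
  unfolding profile_distr_def by (rule prob_space_PiM_D)

lemma root_in_H: "root \<in> space (H 0)"
  by (simp add: space_H)

lemma H_bounds: "v \<in> space (H i) \<Longrightarrow> j \<in> {1..i} \<Longrightarrow> 0 \<le> v j \<and> v j \<le> hi j"
  using lo_nonneg[of j] unfolding space_H PiE_iff by fastforce

lemma upd_in_H: "v \<in> space (H i) \<Longrightarrow> y \<in> space (D (Suc i)) \<Longrightarrow> v(Suc i := y) \<in> space (H (Suc i))"
  by (auto simp: space_H space_D PiE_iff extensional_def le_Suc_eq)

lemma restrict_in_H: "v \<in> space (H j) \<Longrightarrow> i \<le> j \<Longrightarrow> restrict v {1..i} \<in> space (H i)"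
  by (auto simp: space_H PiE_iff)

lemma restrict_H: "v \<in> space (H i) \<Longrightarrow> restrict v {1..i} = v"
  by (auto simp: space_H PiE_iff extensional_restrict)

lemma restrict_upd_le: "j \<le> i \<Longrightarrow> restrict (v(Suc i := y)) {1..j} = restrict v {1..j}"
  by (auto simp: restrict_def)

lemma restrict_upd_H: "v \<in> space (H i) \<Longrightarrow> restrict (v(Suc i := y)) {1..i} = v"
  using restrict_upd_le[of i i v y] restrict_H by simp

lemma last_in_D: "v \<in> space (H (Suc i)) \<Longrightarrow> v (Suc i) \<in> space (D (Suc i))"
  by (auto simp: space_H PiE_iff space_D)

lemma split_H: "v \<in> space (H (Suc i)) \<Longrightarrow> (restrict v {1..i})(Suc i := v (Suc i)) = v"
  by (auto simp: space_H PiE_iff extensional_def fun_eq_iff not_le le_Suc_eq)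

lemma measurable_upd: "(\<lambda>(v, y). v(Suc i := y)) \<in> H i \<Otimes>\<^sub>M D (Suc i) \<rightarrow>\<^sub>M H (Suc i)"
proof -
  have "insert (Suc i) {1..i} = {1..Suc i}" by auto
  then show ?thesis
    using measurable_add_dim[of "Suc i" "{1..i}" D] by (simp add: profile_distr_def)
qed

lemma measurable_upd_right:
  assumes "v \<in> space (H i)"
  shows "(\<lambda>y. v(Suc i := y)) \<in> D (Suc i) \<rightarrow>\<^sub>M H (Suc i)"
  using measurable_compose[OF measurable_Pair1'[OF assms] measurable_upd] by simp

lemma measurable_restrict_H: "i \<le> j \<Longrightarrow> (\<lambda>v. restrict v {1..i}) \<in> H j \<rightarrow>\<^sub>M H i"
  unfolding profile_distr_def by (intro measurable_restrict_subset) auto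

lemma measurable_comp_H: "i \<in> {1..j} \<Longrightarrow> (\<lambda>v. v i) \<in> borel_measurable (H j)"
  using measurable_compose[OF measurable_component_singleton[of i "{1..j}" D] measurable_D_borel[of "\<lambda>y. y"]]
  by (simp add: profile_distr_def)

abbreviation splice :: "nat \<Rightarrow> (nat \<Rightarrow> real) \<Rightarrow> (nat \<Rightarrow> real) \<Rightarrow> nat \<Rightarrow> real" where
  "splice i v w \<equiv> merge {1..i} {i<..k} (v, w)"

lemma measurable_splice2: "i \<le> k \<Longrightarrow> (\<lambda>(v, w). splice i v w) \<in> H i \<Otimes>\<^sub>M Pi\<^sub>M {i<..k} D \<rightarrow>\<^sub>M H k"
proof -
  assume "i \<le> k"
  then have "{1..i} \<union> {i<..k} = {1..k}" by auto
  then show ?thesis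
    using measurable_merge[of "{1..i}" "{i<..k}" D] by (simp add: profile_distr_def case_prod_beta')
qed

lemma measurable_splice: "i \<le> k \<Longrightarrow> v \<in> space (H i) \<Longrightarrow> splice i v \<in> Pi\<^sub>M {i<..k} D \<rightarrow>\<^sub>M H k"
  using measurable_compose[OF measurable_Pair1' measurable_splice2] by simp

lemma splice_in_H: "i \<le> k \<Longrightarrow> v \<in> space (H i) \<Longrightarrow> w \<in> space (Pi\<^sub>M {i<..k} D) \<Longrightarrow> splice i v w \<in> space (H k)"
  by (rule measurable_space[OF measurable_splice])

lemma splice_apply_le: "j \<in> {1..i} \<Longrightarrow> splice i v w j = v j"
  by (simp add: merge_def)

lemma restrict_splice_le: "j \<le> i \<Longrightarrow> restrict (splice i v w) {1..j} = restrict v {1..j}"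
  by (auto simp: restrict_def merge_def)

lemma splice_k: "v \<in> space (H k) \<Longrightarrow> splice k v w = v"
  by (auto simp: merge_def space_H PiE_iff extensional_def)

lemma integrable_bounded_H:
  fixes g :: "(nat \<Rightarrow> real) \<Rightarrow> real"
  assumes "i \<le> k" "v \<in> space (H i)" "g \<in> borel_measurable (H k)"
    and "\<And>w. w \<in> space (H k) \<Longrightarrow> \<bar>g w\<bar> \<le> B"
  shows "integrable (Pi\<^sub>M {i<..k} D) (\<lambda>w. g (splice i v w))"
proof -
  interpret prob_space "Pi\<^sub>M {i<..k} D" by (rule prob_space_PiM_D)
  show ?thesis
    using assms measurable_compose[OF measurable_splice[OF assms(1,2)] assms(3)] splice_in_H
    by (intro integrable_const_bound[where B = B]) auto
qed

text \<open>The tower property: Fubini after splitting the value of day \<open>Suc i\<close> off the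
  future values.\<close>

lemma cont_exp_step:
  assumes i: "i < k" and v: "v \<in> space (H i)"
    and g: "g \<in> borel_measurable (H k)"
    and int: "integrable (Pi\<^sub>M {i<..k} D) (\<lambda>w. g (splice i v w))"
  shows "integrable (D (Suc i)) (\<lambda>y. cont_exp k D (Suc i) (v(Suc i := y)) g)"
    and "cont_exp k D i v g = (\<integral>y. cont_exp k D (Suc i) (v(Suc i := y)) g \<partial>D (Suc i))"
proof -
  let ?R = "Pi\<^sub>M {Suc i<..k} D"
  interpret R: prob_space ?R by (rule prob_space_PiM_D)
  interpret Y: prob_space "D (Suc i)" by (rule prob_D)
  interpret P: pair_sigma_finite "D (Suc i)" ?R ..
  have ins: "insert (Suc i) {Suc i<..k} = {i<..k}" using i by auto
  let ?h = "\<lambda>(y, w). w(Suc i := y)"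
  have h: "?h \<in> D (Suc i) \<Otimes>\<^sub>M ?R \<rightarrow>\<^sub>M Pi\<^sub>M {i<..k} D"
    unfolding ins[symmetric] by measurable
  have d: "distr (D (Suc i) \<Otimes>\<^sub>M ?R) (Pi\<^sub>M {i<..k} D) ?h = Pi\<^sub>M {i<..k} D"
    using distr_pair_PiM_eq_PiM[of "{Suc i<..k}" D "Suc i"] prob_D unfolding ins by simp
  have gm: "(\<lambda>w. g (splice i v w)) \<in> borel_measurable (Pi\<^sub>M {i<..k} D)"
    using measurable_compose[OF measurable_splice g] i v by simp
  have splice_eq: "splice i v (w(Suc i := y)) = splice (Suc i) (v(Suc i := y)) w" for y w
    using i by (auto simp: merge_def fun_eq_iff)
  have eq: "g (splice i v (?h q)) = g (splice (Suc i) (v(Suc i := fst q)) (snd q))" for q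
    unfolding case_prod_beta splice_eq ..
  have int': "integrable (D (Suc i) \<Otimes>\<^sub>M ?R) (\<lambda>q. g (splice (Suc i) (v(Suc i := fst q)) (snd q)))"
    using int integrable_distr_eq[OF h gm] unfolding d eq by simp
  show "integrable (D (Suc i)) (\<lambda>y. cont_exp k D (Suc i) (v(Suc i := y)) g)"
    using P.integrable_fst'[OF int'] by (simp add: cont_exp_def)
  have "cont_exp k D i v g = (\<integral>q. g (splice (Suc i) (v(Suc i := fst q)) (snd q)) \<partial>(D (Suc i) \<Otimes>\<^sub>M ?R))"
    unfolding cont_exp_def using integral_distr[OF h gm] unfolding d eq by simp
  also have "\<dots> = (\<integral>y. cont_exp k D (Suc i) (v(Suc i := y)) g \<partial>D (Suc i))"
    using P.integral_fst'[OF int'] by (simp add: cont_exp_def)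
  finally show "cont_exp k D i v g = (\<integral>y. cont_exp k D (Suc i) (v(Suc i := y)) g \<partial>D (Suc i))" .
qed

lemma cont_exp_k: "v \<in> space (H k) \<Longrightarrow> cont_exp k D k v g = g v"
proof -
  assume v: "v \<in> space (H k)"
  interpret prob_space "Pi\<^sub>M {k<..k} D" by (rule prob_space_PiM_D)
  show ?thesis unfolding cont_exp_def splice_k[OF v] using prob_space by simp
qed

text \<open>\<open>U i v\<close> stands for the total utility, over all days, that the mechanism grants in expectation
  after the history \<open>v\<^sub>1, \<dots>, v\<^sub>i\<close>. In these terms periodic incentive compatibility says that
  \<open>x\<^sub>i\<close> is a subgradient of \<open>U\<^sub>i\<close> in \<open>v\<^sub>i\<close>.\<close>

definition admissible :: "(nat \<Rightarrow> (nat \<Rightarrow> real) \<Rightarrow> real) \<Rightarrow> (nat \<Rightarrow> (nat \<Rightarrow> real) \<Rightarrow> real) \<Rightarrow> bool" where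
  "admissible x U \<longleftrightarrow>
    (\<forall>i\<in>{1..k}. x i \<in> borel_measurable (H i) \<and> (\<forall>v\<in>space (H i). 0 \<le> x i v \<and> x i v \<le> 1)) \<and>
    (\<forall>i\<le>k. U i \<in> borel_measurable (H i) \<and> (\<forall>v\<in>space (H i). 0 \<le> U i v)) \<and>
    (\<forall>i<k. \<forall>v\<in>space (H i).
       integrable (D (Suc i)) (\<lambda>y. U (Suc i) (v(Suc i := y))) \<and>
       U i v = (\<integral>y. U (Suc i) (v(Suc i := y)) \<partial>D (Suc i)) \<and>
       (\<forall>y\<in>space (D (Suc i)). \<forall>y'\<in>space (D (Suc i)).
          U (Suc i) (v(Suc i := y')) + (y - y') * x (Suc i) (v(Suc i := y'))
            \<le> U (Suc i) (v(Suc i := y))))"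

definition welfare :: "(nat \<Rightarrow> (nat \<Rightarrow> real) \<Rightarrow> real) \<Rightarrow> real" where
  "welfare x = (\<integral>v. (\<Sum>j\<in>{1..k}. v j * x j (restrict v {1..j})) \<partial>H k)"

text \<open>What the buyer pays is the welfare minus what he keeps, and \<open>U 0 root\<close> is
  the total utility he expects before day 1.\<close>

definition objective :: "(nat \<Rightarrow> (nat \<Rightarrow> real) \<Rightarrow> real) \<Rightarrow> (nat \<Rightarrow> (nat \<Rightarrow> real) \<Rightarrow> real) \<Rightarrow> real" where
  "objective x U = welfare x - U 0 root"

lemma admissibleD:
  assumes "admissible x U"
  shows "\<And>i. i \<in> {1..k} \<Longrightarrow> x i \<in> borel_measurable (H i)"
    and "\<And>i v. i \<in> {1..k} \<Longrightarrow> v \<in> space (H i) \<Longrightarrow> 0 \<le> x i v \<and> x i v \<le> 1"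
    and "\<And>i. i \<le> k \<Longrightarrow> U i \<in> borel_measurable (H i)"
    and "\<And>i v. i \<le> k \<Longrightarrow> v \<in> space (H i) \<Longrightarrow> 0 \<le> U i v"
    and "\<And>i v. i < k \<Longrightarrow> v \<in> space (H i) \<Longrightarrow> integrable (D (Suc i)) (\<lambda>y. U (Suc i) (v(Suc i := y)))"
    and "\<And>i v. i < k \<Longrightarrow> v \<in> space (H i) \<Longrightarrow> U i v = (\<integral>y. U (Suc i) (v(Suc i := y)) \<partial>D (Suc i))"
    and "\<And>i v y y'. i < k \<Longrightarrow> v \<in> space (H i) \<Longrightarrow> y \<in> space (D (Suc i)) \<Longrightarrow> y' \<in> space (D (Suc i)) \<Longrightarrow>
      U (Suc i) (v(Suc i := y')) + (y - y') * x (Suc i) (v(Suc i := y')) \<le> U (Suc i) (v(Suc i := y))"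
  using assms unfolding admissible_def by blast+

lemma welfare_summand:
  fixes q :: "(nat \<Rightarrow> real) \<Rightarrow> real"
  assumes q: "q \<in> borel_measurable (H j)" "\<And>v. v \<in> space (H j) \<Longrightarrow> 0 \<le> q v \<and> q v \<le> 1"
    and j: "j \<in> {1..k}"
  shows "(\<lambda>v. v j * q (restrict v {1..j})) \<in> borel_measurable (H k)"
    and "\<And>v. v \<in> space (H k) \<Longrightarrow> \<bar>v j * q (restrict v {1..j})\<bar> \<le> hi j"
    and "integrable (H k) (\<lambda>v. v j * q (restrict v {1..j}))"
proof -
  interpret prob_space "H k" by (rule prob_space_H)
  have "(\<lambda>v. q (restrict v {1..j})) \<in> borel_measurable (H k)"
    using j by (intro measurable_compose[OF measurable_restrict_H q(1)]) simp
  then show meas: "(\<lambda>v. v j * q (restrict v {1..j})) \<in> borel_measurable (H k)"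
    using measurable_comp_H[OF j] by (rule borel_measurable_times[rotated])
  show bnd: "\<bar>v j * q (restrict v {1..j})\<bar> \<le> hi j" if v: "v \<in> space (H k)" for v
  proof -
    have "0 \<le> v j" "v j \<le> hi j" using H_bounds[OF v j] by auto
    moreover have "0 \<le> q (restrict v {1..j})" "q (restrict v {1..j}) \<le> 1"
      using q(2)[OF restrict_in_H[OF v]] j by auto
    ultimately show ?thesis
      using mult_mono[of "v j" "hi j" "q (restrict v {1..j})" 1] by (simp add: abs_mult)
  qed
  show "integrable (H k) (\<lambda>v. v j * q (restrict v {1..j}))"
    using meas bnd by (intro integrable_const_bound[where B = "hi j"]) auto
qed

lemma welfare_le:
  assumes "admissible x U"
  shows "welfare x \<le> (\<Sum>j\<in>{1..k}. hi j)"
proof -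
  interpret prob_space "H k" by (rule prob_space_H)
  note ad = admissibleD[OF assms]
  have "v j * x j (restrict v {1..j}) \<le> hi j" if "j \<in> {1..k}" "v \<in> space (H k)" for v j
    using welfare_summand(2)[OF ad(1,2) that(1) that(2)] that(1) by fastforce
  moreover have "integrable (H k) (\<lambda>v. v j * x j (restrict v {1..j}))" if "j \<in> {1..k}" for j
    using that by (intro welfare_summand(3) ad(1,2))
  ultimately have "welfare x \<le> (\<integral>v. (\<Sum>j\<in>{1..k}. hi j) \<partial>H k)"
    unfolding welfare_def
    by (intro integral_mono Bochner_Integration.integrable_sum sum_mono) auto
  then show ?thesis by (simp add: prob_space)
qed

text \<open>Within one day the utility varies by at most \<open>hi (Suc i)\<close>, since its slopes
  are allocations and values lie between 0 and \<open>hi (Suc i)\<close>. Averaging the bound over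
  \<open>y'\<close> turns its right-hand side into \<open>U i v\<close>.\<close>

lemma U_step_le:
  assumes "admissible x U" "i < k" "v \<in> space (H i)" "y \<in> space (D (Suc i))"
  shows "U (Suc i) (v(Suc i := y)) \<le> U i v + hi (Suc i)"
proof -
  interpret Y: prob_space "D (Suc i)" by (rule prob_D)
  note ad = admissibleD[OF assms(1)]
  have "U (Suc i) (v(Suc i := y)) \<le> U (Suc i) (v(Suc i := y')) + hi (Suc i)" if y': "y' \<in> space (D (Suc i))" for y'
  proof -
    have "U (Suc i) (v(Suc i := y)) \<le> U (Suc i) (v(Suc i := y')) + (y - y') * x (Suc i) (v(Suc i := y))"
      using ad(7)[OF assms(2,3) y' assms(4)] by (simp add: algebra_simps)
    moreover have "(y - y') * x (Suc i) (v(Suc i := y)) \<le> hi (Suc i) * 1"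
    proof -
      have "0 \<le> x (Suc i) (v(Suc i := y))" "x (Suc i) (v(Suc i := y)) \<le> 1"
        using ad(2)[of "Suc i" "v(Suc i := y)"] upd_in_H[OF assms(3,4)] assms(2) by auto
      moreover have "y - y' \<le> hi (Suc i)" "0 \<le> hi (Suc i)"
        using y' assms(4) lo_nonneg[of "Suc i"] lo_less_hi[of "Suc i"] by (auto simp: space_D)
      ultimately show ?thesis
        by (meson mult_left_mono mult_right_mono order_trans)
    qed
    ultimately show ?thesis by simp
  qed
  then have "(\<integral>y'. U (Suc i) (v(Suc i := y)) \<partial>D (Suc i)) \<le> (\<integral>y'. U (Suc i) (v(Suc i := y')) + hi (Suc i) \<partial>D (Suc i))"
    using ad(5)[OF assms(2,3)] by (intro integral_mono) auto
  then show ?thesis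
    using ad(5,6)[OF assms(2,3)] by (simp add: Y.prob_space)
qed

text \<open>A bound that depends on the pair only through \<open>U 0 root\<close> is uniform along a
  maximizing sequence, because a nearly maximal objective controls that number.\<close>

lemma U_le:
  assumes "admissible x U" "i \<le> k" "v \<in> space (H i)"
  shows "U i v \<le> U 0 root + (\<Sum>j\<in>{1..i}. hi j)"
  using assms(2,3)
proof (induction i arbitrary: v)
  case 0
  then show ?case by (simp add: space_H)
next
  case (Suc i)
  have "U (Suc i) v = U (Suc i) ((restrict v {1..i})(Suc i := v (Suc i)))"
    using split_H[OF Suc.prems(2)] by simp
  also have "\<dots> \<le> U i (restrict v {1..i}) + hi (Suc i)"
    using Suc.prems restrict_in_H last_in_D by (intro U_step_le[OF assms(1)]) auto
  also have "U i (restrict v {1..i}) \<le> U 0 root + (\<Sum>j\<in>{1..i}. hi j)"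
    by (rule Suc.IH[OF Suc_leD[OF Suc.prems(1)] restrict_in_H[OF Suc.prems(2) le_SucI[OF order_refl]]])
  then have "U i (restrict v {1..i}) + hi (Suc i) \<le> U 0 root + (\<Sum>j\<in>{1..Suc i}. hi j)"
    by simp
  finally show ?case .
qed

section \<open>From feasible mechanisms to admissible pairs\<close>

definition total_utility ::
    "(nat \<Rightarrow> (nat \<Rightarrow> real) \<Rightarrow> real) \<Rightarrow> (nat \<Rightarrow> (nat \<Rightarrow> real) \<Rightarrow> real) \<Rightarrow> (nat \<Rightarrow> real) \<Rightarrow> real" where
  "total_utility x p w = (\<Sum>j\<in>{1..k}. stage_utility x p j w w)"

lemma stage_utility_cong:
  "restrict r {1..j} = restrict r' {1..j} \<Longrightarrow> v j = v' j \<Longrightarrow>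
    stage_utility x p j v r = stage_utility x p j v' r'"
  by (simp add: stage_utility_def)

lemma stage_utility_cong_same:
  assumes "restrict v {1..j} = restrict v' {1..j}" "1 \<le> j"
  shows "stage_utility x p j v v = stage_utility x p j v' v'"
proof (rule stage_utility_cong[OF assms(1)])
  show "v j = v' j" using fun_cong[OF assms(1), of j] assms(2) unfolding restrict_def by simp
qed

lemma stage_utility_measurable:
  assumes "mechanism k D x p" "j \<in> {1..k}"
  shows "(\<lambda>w. stage_utility x p j w w) \<in> borel_measurable (H k)"
proof -
  have x: "x j \<in> borel_measurable (H j)" "\<And>v. v \<in> space (H j) \<Longrightarrow> 0 \<le> x j v \<and> x j v \<le> 1"
    and p: "p j \<in> borel_measurable (H j)"
    using assms unfolding mechanism_def by blast+
  have "(\<lambda>w. p j (restrict w {1..j})) \<in> borel_measurable (H k)"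
    using assms(2) by (intro measurable_compose[OF measurable_restrict_H p]) simp
  then show ?thesis
    unfolding stage_utility_def using welfare_summand(1)[OF x assms(2)] by (rule borel_measurable_diff[rotated])
qed

lemma stage_utility_integrable:
  assumes m: "mechanism k D x p" and j: "j \<in> {1..k}" and i: "i \<le> k" and v: "v \<in> space (H i)"
  shows "integrable (Pi\<^sub>M {i<..k} D) (\<lambda>w. stage_utility x p j (splice i v w) (splice i v w))"
proof (cases "j \<le> i")
  case True
  interpret prob_space "Pi\<^sub>M {i<..k} D" by (rule prob_space_PiM_D)
  have "stage_utility x p j (splice i v w) (splice i v w) = stage_utility x p j v v" for w
    using j restrict_splice_le[OF True] by (intro stage_utility_cong_same) auto
  then show ?thesis by simp
next
  case False
  have x: "x j \<in> borel_measurable (H j)" "\<And>v. v \<in> space (H j) \<Longrightarrow> 0 \<le> x j v \<and> x j v \<le> 1"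
    using m j unfolding mechanism_def by blast+
  have "j \<in> {i<..k}" "i \<in> {0..k}" using False j i by auto
  then have "integrable (Pi\<^sub>M {i<..k} D) (\<lambda>w. p j (restrict (splice i v w) {1..j}))"
    using m v unfolding mechanism_def by blast
  moreover have "integrable (Pi\<^sub>M {i<..k} D) (\<lambda>w. splice i v w j * x j (restrict (splice i v w) {1..j}))"
    by (rule integrable_bounded_H[OF i v welfare_summand(1,2)[OF x j]])
  ultimately show ?thesis unfolding stage_utility_def by (rule Bochner_Integration.integrable_diff[rotated])
qed

lemma total_utility_measurable:
  "mechanism k D x p \<Longrightarrow> total_utility x p \<in> borel_measurable (H k)"
  unfolding total_utility_def[abs_def] by (intro borel_measurable_sum stage_utility_measurable)

lemma total_utility_integrable:
  "mechanism k D x p \<Longrightarrow> i \<le> k \<Longrightarrow> v \<in> space (H i) \<Longrightarrow>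
    integrable (Pi\<^sub>M {i<..k} D) (\<lambda>w. total_utility x p (splice i v w))"
  unfolding total_utility_def by (intro Bochner_Integration.integrable_sum stage_utility_integrable)

lemma cont_exp_total_utility:
  assumes m: "mechanism k D x p" and i: "i \<le> k" and v: "v \<in> space (H i)"
  shows "cont_exp k D i v (total_utility x p) =
    (\<Sum>j\<in>{1..i}. stage_utility x p j v v) + cont_exp k D i v (\<lambda>w. \<Sum>j\<in>{i<..k}. stage_utility x p j w w)"
proof -
  interpret prob_space "Pi\<^sub>M {i<..k} D" by (rule prob_space_PiM_D)
  have split: "total_utility x p (splice i v w) = (\<Sum>j\<in>{1..i}. stage_utility x p j v v) +
      (\<Sum>j\<in>{i<..k}. stage_utility x p j (splice i v w) (splice i v w))" for w
  proof -
    have "{1..k} = {1..i} \<union> {i<..k}" using i by auto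
    then have "total_utility x p (splice i v w) = (\<Sum>j\<in>{1..i}. stage_utility x p j (splice i v w) (splice i v w)) +
        (\<Sum>j\<in>{i<..k}. stage_utility x p j (splice i v w) (splice i v w))"
      unfolding total_utility_def by (simp only:) (rule sum.union_disjoint; auto)
    also have "(\<Sum>j\<in>{1..i}. stage_utility x p j (splice i v w) (splice i v w)) = (\<Sum>j\<in>{1..i}. stage_utility x p j v v)"
      by (intro sum.cong refl stage_utility_cong_same restrict_splice_le) auto
    finally show ?thesis .
  qed
  have "integrable (Pi\<^sub>M {i<..k} D) (\<lambda>w. \<Sum>j\<in>{i<..k}. stage_utility x p j (splice i v w) (splice i v w))"
    using m i v by (intro Bochner_Integration.integrable_sum stage_utility_integrable) auto
  then show ?thesis
    unfolding cont_exp_def split by (simp add: prob_space)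
qed

text \<open>\<open>U\<close> includes the stage utilities of past days, so that the averaging
  condition is just the tower property. These past terms do not depend on the current report and
  cancel from the incentive constraint. What remains is the subgradient inequality, because a buyer
  of value \<open>y\<close> who reports \<open>y'\<close> gets the utility of type \<open>y'\<close>
  plus \<open>(y - y')\<close> times the allocation.\<close>

lemma admissible_of_feasible:
  assumes "feasible k D x p"
  defines "U \<equiv> \<lambda>i v. cont_exp k D i v (total_utility x p)"
  shows "admissible x U" and "objective x U = revenue k D p"
proof -
  have m: "mechanism k D x p" and ic: "periodic_IC k D x p" and ir: "ex_post_IR k D x p"
    using assms(1) by (auto simp: feasible_def)
  have x: "x i \<in> borel_measurable (H i)" "\<And>v. v \<in> space (H i) \<Longrightarrow> 0 \<le> x i v \<and> x i v \<le> 1" if "i \<in> {1..k}" for i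
    using m that unfolding mechanism_def by blast+
  have tot_nonneg: "0 \<le> total_utility x p w" if w: "w \<in> space (H k)" for w
    unfolding total_utility_def
  proof (rule sum_nonneg)
    fix j assume j: "j \<in> {1..k}"
    have "0 \<le> stage_utility x p j (restrict w {1..j}) (restrict w {1..j})"
      using ir j restrict_in_H[OF w] by (auto simp: ex_post_IR_def)
    also have "\<dots> = stage_utility x p j w w"
      using j by (intro stage_utility_cong_same) auto
    finally show "0 \<le> stage_utility x p j w w" .
  qed
  have meas: "U i \<in> borel_measurable (H i)" if i: "i \<le> k" for i
  proof -
    interpret prob_space "Pi\<^sub>M {i<..k} D" by (rule prob_space_PiM_D)
    have "(\<lambda>(v, w). total_utility x p (splice i v w)) \<in> borel_measurable (H i \<Otimes>\<^sub>M Pi\<^sub>M {i<..k} D)"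
      using measurable_compose[OF measurable_splice2[OF i] total_utility_measurable[OF m]] by (simp add: case_prod_beta')
    then show ?thesis unfolding U_def cont_exp_def by (rule borel_measurable_lebesgue_integral)
  qed
  have nonneg: "0 \<le> U i v" if "i \<le> k" "v \<in> space (H i)" for i v
    unfolding U_def cont_exp_def using splice_in_H[OF that] tot_nonneg
    by (intro Bochner_Integration.integral_nonneg) auto
  have sub: "U (Suc i) (v(Suc i := y')) + (y - y') * x (Suc i) (v(Suc i := y')) \<le> U (Suc i) (v(Suc i := y))"
    if i: "i < k" and v: "v \<in> space (H i)" and y: "y \<in> space (D (Suc i))" and y': "y' \<in> space (D (Suc i))" for i v y y'
  proof -
    let ?a = "v(Suc i := y)" and ?b = "v(Suc i := y')"
    let ?C = "\<lambda>a. cont_exp k D (Suc i) a (\<lambda>w. \<Sum>j\<in>{Suc i<..k}. stage_utility x p j w w)"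
    have ab: "?a \<in> space (H (Suc i))" "?b \<in> space (H (Suc i))" using v y y' by (auto intro: upd_in_H)
    have upd: "?a(Suc i := y') = ?b" by simp
    \<comment> \<open>Later stage utilities depend on the current value only through the report, so
      the continuation after a misreport is that of a buyer who truthfully reports
      \<open>y'\<close>.\<close>
    have C: "cont_exp k D (Suc i) ?a (\<lambda>w. \<Sum>j\<in>{Suc i<..k}. stage_utility x p j w (w(Suc i := y'))) = ?C ?b"
    proof -
      have splice_b: "(splice (Suc i) ?a w)(Suc i := y') = splice (Suc i) ?b w" for w
        by (auto simp: merge_def fun_eq_iff)
      have "stage_utility x p j (splice (Suc i) ?a w) (splice (Suc i) ?b w) = stage_utility x p j (splice (Suc i) ?b w) (splice (Suc i) ?b w)"
        if "j \<in> {Suc i<..k}" for j w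
        using that by (intro stage_utility_cong) (auto simp: merge_def)
      then show ?thesis unfolding cont_exp_def splice_b by simp
    qed
    have "Suc i \<in> {1..k}" using i by simp
    then have "stage_utility x p (Suc i) ?a ?a + ?C ?a \<ge> stage_utility x p (Suc i) ?a (?a(Suc i := y')) +
        cont_exp k D (Suc i) ?a (\<lambda>w. \<Sum>j\<in>{Suc i<..k}. stage_utility x p j w (w(Suc i := y')))"
      using ic ab(1) y' unfolding periodic_IC_def by blast
    then have main: "stage_utility x p (Suc i) ?a ?b + ?C ?b \<le> stage_utility x p (Suc i) ?a ?a + ?C ?a"
      unfolding C upd .
    have "stage_utility x p (Suc i) ?a ?b = stage_utility x p (Suc i) ?b ?b + (y - y') * x (Suc i) ?b"
      unfolding stage_utility_def restrict_H[OF ab(2)] by (simp add: algebra_simps)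
    moreover have "(\<Sum>j\<in>{1..i}. stage_utility x p j ?a ?a) = (\<Sum>j\<in>{1..i}. stage_utility x p j ?b ?b)"
      by (intro sum.cong refl stage_utility_cong_same) (auto simp: restrict_upd_le)
    moreover have "U (Suc i) c = (\<Sum>j\<in>{1..i}. stage_utility x p j c c) + stage_utility x p (Suc i) c c + ?C c"
      if "c \<in> space (H (Suc i))" for c
      unfolding U_def using cont_exp_total_utility[OF m _ that] i by simp
    ultimately show ?thesis using main ab by simp
  qed
  show "admissible x U"
    unfolding admissible_def
  proof (intro conjI allI ballI impI)
    fix i v assume iv: "i < k" "v \<in> space (H i)"
    show "integrable (D (Suc i)) (\<lambda>y. U (Suc i) (v(Suc i := y)))"
      and "U i v = (\<integral>y. U (Suc i) (v(Suc i := y)) \<partial>D (Suc i))"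
      unfolding U_def using iv
      by (intro cont_exp_step total_utility_measurable total_utility_integrable m; simp)+
  qed (use x meas nonneg sub in auto)
  show "objective x U = revenue k D p"
  proof -
    have ivs: "{0<..k} = {1..k}" by auto
    have splice0: "splice 0 root w = w" if "w \<in> space (H k)" for w
      using that by (auto simp: merge_def space_H PiE_iff extensional_def fun_eq_iff)
    have "U 0 root = (\<integral>w. total_utility x p (splice 0 root w) \<partial>H k)"
      by (simp add: U_def cont_exp_def profile_distr_def ivs)
    also have "\<dots> = (\<integral>w. total_utility x p w \<partial>H k)"
      by (intro Bochner_Integration.integral_cong refl) (simp only: splice0)
    finally have U0: "U 0 root = (\<integral>w. total_utility x p w \<partial>H k)" .
    have "integrable (H k) (\<lambda>w. total_utility x p (splice 0 root w))"
      using total_utility_integrable[OF m, of 0 root] root_in_H unfolding ivs by (simp add: profile_distr_def)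
    then have int: "integrable (H k) (total_utility x p)"
      by (rule Bochner_Integration.integrable_cong[OF refl, THEN iffD1, rotated]) (simp only: splice0)
    have "integrable (H k) (\<lambda>w. w j * x j (restrict w {1..j}))" if "j \<in> {1..k}" for j
      by (rule welfare_summand(3)[OF x[OF that] that])
    then have "objective x U = (\<integral>w. (\<Sum>j\<in>{1..k}. w j * x j (restrict w {1..j})) - total_utility x p w \<partial>H k)"
      unfolding objective_def welfare_def U0 using int
      by (subst Bochner_Integration.integral_diff) (auto intro!: Bochner_Integration.integrable_sum)
    also have "\<dots> = revenue k D p"
      unfolding revenue_def total_utility_def stage_utility_def sum_subtractf by simp
    finally show ?thesis .
  qed
qed

section \<open>From admissible pairs to mechanisms with deferred utility\<close>

text \<open>All utility is paid out on the last day, when \<open>U\<^sub>k\<close> is the total utility.\<close>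

definition deferred_payment ::
    "(nat \<Rightarrow> (nat \<Rightarrow> real) \<Rightarrow> real) \<Rightarrow> (nat \<Rightarrow> (nat \<Rightarrow> real) \<Rightarrow> real) \<Rightarrow> nat \<Rightarrow> (nat \<Rightarrow> real) \<Rightarrow> real" where
  "deferred_payment x U i v = (if i = k then v i * x i v - U k v else v i * x i v)"

lemma stage_utility_deferred:
  assumes "j \<in> {1..k}"
  shows "stage_utility x (deferred_payment x U) j v r =
    (v j - r j) * x j (restrict r {1..j}) + (if j = k then U k (restrict r {1..k}) else 0)"
  using assms by (auto simp: stage_utility_def deferred_payment_def algebra_simps)

lemma U_bounded:
  assumes "admissible x U"
  shows "\<exists>B. \<forall>i\<le>k. \<forall>v\<in>space (H i). \<bar>U i v\<bar> \<le> B"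
proof (intro exI allI ballI impI)
  fix i v assume iv: "i \<le> k" "v \<in> space (H i)"
  have "(\<Sum>j\<in>{1..i}. hi j) \<le> (\<Sum>j\<in>{1..k}. hi j)"
    using iv lo_nonneg lo_less_hi by (intro sum_mono2) (auto intro: less_imp_le le_less_trans)
  then show "\<bar>U i v\<bar> \<le> U 0 root + (\<Sum>j\<in>{1..k}. hi j)"
    using U_le[OF assms iv] admissibleD(4)[OF assms iv] by simp
qed

text \<open>The averaging condition makes \<open>U\<close> a martingale along the history. Backward
  induction from day \<open>k\<close> applies the tower property to the bounded function
  \<open>U k\<close>.\<close>

lemma cont_exp_U:
  assumes ad: "admissible x U" and "i \<le> k" "v \<in> space (H i)"
  shows "cont_exp k D i v (U k) = U i v"
  using assms(2,3)
proof (induction arbitrary: v rule: inc_induct)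
  case base
  then show ?case by (rule cont_exp_k)
next
  case (step i)
  obtain B where B: "\<And>i v. i \<le> k \<Longrightarrow> v \<in> space (H i) \<Longrightarrow> \<bar>U i v\<bar> \<le> B"
    using U_bounded[OF ad] by blast
  note Uk = admissibleD(3)[OF ad order_refl]
  have i: "i < k" "i \<le> k" using step by auto
  have "cont_exp k D i v (U k) = (\<integral>y. cont_exp k D (Suc i) (v(Suc i := y)) (U k) \<partial>D (Suc i))"
    by (rule cont_exp_step(2)[OF i(1) step.prems Uk integrable_bounded_H[OF i(2) step.prems Uk B[OF order_refl]]])
  also have "\<dots> = (\<integral>y. U (Suc i) (v(Suc i := y)) \<partial>D (Suc i))"
    by (intro Bochner_Integration.integral_cong refl step.IH upd_in_H step.prems)
  also have "\<dots> = U i v"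
    using admissibleD(6)[OF ad i(1) step.prems] by simp
  finally show ?case .
qed

text \<open>Under deferral a report \<open>r\<close> on day \<open>i\<close> earns
  \<open>(v i - r i) * x i r\<close> at once and \<open>U i r\<close> in expectation at the end, so
  incentive compatibility becomes the subgradient inequality. Individual rationality is an equality
  before day \<open>k\<close> and says \<open>U k\<close> is nonnegative on day
  \<open>k\<close>.\<close>

lemma feasible_deferred:
  assumes ad: "admissible x U" and k: "1 \<le> k"
  defines "p \<equiv> deferred_payment x U"
  shows "feasible k D x p" and "revenue k D p = objective x U"
proof -
  obtain B where B: "\<And>i v. i \<le> k \<Longrightarrow> v \<in> space (H i) \<Longrightarrow> \<bar>U i v\<bar> \<le> B"
    using U_bounded[OF ad] by blast
  note adD = admissibleD[OF ad]
  have xm: "(\<lambda>v. v i * x i v) \<in> borel_measurable (H i)" if "i \<in> {1..k}" for i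
    using that by (intro borel_measurable_times measurable_comp_H adD(1)) auto
  have pm: "p i \<in> borel_measurable (H i)" if "i \<in> {1..k}" for i
    unfolding p_def deferred_payment_def[abs_def] using xm[OF that] adD(3)[OF order_refl]
    by (cases "i = k") (simp_all add: borel_measurable_diff)
  have pb: "\<bar>p j (restrict v {1..j})\<bar> \<le> hi j + B" if j: "j \<in> {1..k}" and v: "v \<in> space (H k)" for j v
  proof -
    have "\<bar>v j * x j (restrict v {1..j})\<bar> \<le> hi j"
      by (rule welfare_summand(2)[OF adD(1,2) j v]) (use j in auto)
    moreover have "\<bar>U k v\<bar> \<le> B" by (rule B[OF order_refl v])
    ultimately show ?thesis
      using j restrict_H[OF v] by (auto simp: p_def deferred_payment_def)
  qed
  have mech: "mechanism k D x p"
    unfolding mechanism_def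
  proof (intro conjI ballI)
    fix i v j assume iv: "i \<in> {0..k}" "v \<in> space (H i)" and j: "j \<in> {i<..k}"
    have j': "j \<in> {1..k}" using j by auto
    have "(\<lambda>w. p j (restrict w {1..j})) \<in> borel_measurable (H k)"
      using j' by (intro measurable_compose[OF measurable_restrict_H pm]) auto
    then show "integrable (Pi\<^sub>M {i<..k} D) (\<lambda>w. p j (restrict (splice i v w) {1..j}))"
      using iv(1) by (intro integrable_bounded_H[OF _ iv(2) _ pb[OF j']]) auto
  qed (use adD(1,2) pm in auto)
  have su: "stage_utility x p j v r = (v j - r j) * x j (restrict r {1..j}) + (if j = k then U k (restrict r {1..k}) else 0)"
    if "j \<in> {1..k}" for j v r
    unfolding p_def by (rule stage_utility_deferred[OF that])
  have IR: "ex_post_IR k D x p"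
    unfolding ex_post_IR_def using adD(4)[OF order_refl] restrict_in_H[OF _ order_refl, of _ k] by (auto simp: su)
  have later: "(\<Sum>j\<in>{i<..k}. stage_utility x p j w (w(i := y))) = (if i = k then 0 else U k (restrict (w(i := y)) {1..k}))"
    if "i \<in> {1..k}" for i w y
  proof -
    have "(\<Sum>j\<in>{i<..k}. stage_utility x p j w (w(i := y))) =
        (\<Sum>j\<in>{i<..k}. if j = k then U k (restrict (w(i := y)) {1..k}) else 0)"
      using that by (intro sum.cong refl) (auto simp: su)
    then show ?thesis using that by auto
  qed
  have IC: "periodic_IC k D x p"
    unfolding periodic_IC_def
  proof (intro ballI)
    fix i v y assume i: "i \<in> {1..k}" and v: "v \<in> space (H i)" and y: "y \<in> space (D i)"
    obtain l where l: "i = Suc l" "l < k" using i by (cases i) auto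
    define h where "h = restrict v {1..l}"
    have h: "h \<in> space (H l)" unfolding h_def using v l by (intro restrict_in_H) auto
    have vh: "v = h(i := v i)" using split_H[of v l] v l by (simp add: h_def)
    have vi: "v i \<in> space (D i)" using last_in_D[of v l] v l by simp
    have vy: "v(i := y) = h(i := y)" by (subst vh) simp
    have vyH: "v(i := y) \<in> space (H i)" unfolding vy using upd_in_H[OF h] y l by simp
    \<comment> \<open>Stated for any report so that it serves both sides of the incentive
      constraint. For \<open>i = k\<close> the continuation is empty and \<open>U k r\<close> is
      already contained in the stage utility.\<close>
    have split: "stage_utility x p i v r + cont_exp k D i v (\<lambda>w. \<Sum>j\<in>{i<..k}. stage_utility x p j w (w(i := r i)))
        = (v i - r i) * x i r + U i r" if r: "r \<in> space (H i)" and rv: "r = v(i := r i)" for r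
    proof (cases "i = k")
      case True
      then show ?thesis using r restrict_H[OF r] su[OF i, of v r] later[OF i]
        by (simp add: cont_exp_def)
    next
      case False
      have "cont_exp k D i v (\<lambda>w. \<Sum>j\<in>{i<..k}. stage_utility x p j w (w(i := r i))) = cont_exp k D i r (U k)"
        unfolding cont_exp_def
      proof (intro Bochner_Integration.integral_cong refl)
        fix w assume w: "w \<in> space (Pi\<^sub>M {i<..k} D)"
        have "(splice i v w)(i := r i) = splice i r w"
          using i by (subst (2) rv) (auto simp: merge_def fun_eq_iff)
        then show "(\<Sum>j\<in>{i<..k}. stage_utility x p j (splice i v w) ((splice i v w)(i := r i))) = U k (splice i r w)"
          unfolding later[OF i] using False restrict_H[OF splice_in_H[OF _ r w]] i by simp
      qed
      also have "\<dots> = U i r" using i by (intro cont_exp_U[OF ad _ r]) simp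
      finally show ?thesis using False su[OF i, of v r] restrict_H[OF r] by simp
    qed
    have self: "cont_exp k D i v (\<lambda>w. \<Sum>j\<in>{i<..k}. stage_utility x p j w w) =
        cont_exp k D i v (\<lambda>w. \<Sum>j\<in>{i<..k}. stage_utility x p j w (w(i := v i)))"
    proof -
      have "(splice i v w)(i := v i) = splice i v w" for w
        using i by (intro fun_upd_idem splice_apply_le) simp
      then show ?thesis unfolding cont_exp_def by (simp only:)
    qed
    have "(v i - y) * x i (v(i := y)) + U i (v(i := y)) \<le> U i v"
      using adD(7)[OF l(2) h, of "v i" y] vi y unfolding l(1)[symmetric] vy by (simp add: vh[symmetric])
    then show "stage_utility x p i v (v(i := y)) + cont_exp k D i v (\<lambda>w. \<Sum>j\<in>{i<..k}. stage_utility x p j w (w(i := y)))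
        \<le> stage_utility x p i v v + cont_exp k D i v (\<lambda>w. \<Sum>j\<in>{i<..k}. stage_utility x p j w w)"
      unfolding self using split[OF vyH] split[OF v] by simp
  qed
  show feas: "feasible k D x p" using mech IC IR by (simp add: feasible_def)
  \<comment> \<open>The revenue formula for feasible mechanisms applies to \<open>p\<close> itself;
    it remains to see that the utility which \<open>p\<close> induces at the empty history is again
    \<open>U 0 root\<close>.\<close>
  have "total_utility x p w = U k w" if w: "w \<in> space (H k)" for w
  proof -
    have "total_utility x p w = (\<Sum>j\<in>{1..k}. if j = k then U k (restrict w {1..k}) else 0)"
      unfolding total_utility_def by (intro sum.cong refl) (simp add: su)
    then show ?thesis using restrict_H[OF w] k by simp
  qed
  then have "cont_exp k D 0 root (total_utility x p) = cont_exp k D 0 root (U k)"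
    unfolding cont_exp_def by (intro Bochner_Integration.integral_cong refl) (metis splice_in_H root_in_H le0)
  also have "\<dots> = U 0 root" by (rule cont_exp_U[OF ad le0 root_in_H])
  finally show "revenue k D p = objective x U"
    using admissible_of_feasible(2)[OF feas] by (simp add: objective_def)
qed

end

subsection \<open>The limit of a maximizing sequence\<close>

text \<open>Convergence is required with respect to \<open>Q\<close> because the constraints also
  bind at reports that \<open>D\<close> ignores. All days are read off one full profile, so a single
  exceptional set covers them.\<close>

locale convergent_sales = sequential_sale +
  fixes X V :: "nat \<Rightarrow> nat \<Rightarrow> (nat \<Rightarrow> real) \<Rightarrow> real" and B :: real
  assumes adm: "\<And>n. admissible (X n) (V n)"
    and V_bound: "\<And>n i v. i \<le> k \<Longrightarrow> v \<in> space (H i) \<Longrightarrow> V n i v \<le> B"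
    and AE_convergent: "AE v in Pi\<^sub>M {1..k} Q. \<forall>j\<le>k. convergent (\<lambda>n. V n j (restrict v {1..j})) \<and>
      (1 \<le> j \<longrightarrow> convergent (\<lambda>n. X n j (restrict v {1..j})))"
begin

text \<open>The guard reflects that day 0 has a utility but no allocation.\<close>

definition conv :: "nat \<Rightarrow> (nat \<Rightarrow> real) \<Rightarrow> bool" where
  "conv j v \<longleftrightarrow> convergent (\<lambda>n. V n j v) \<and> (1 \<le> j \<longrightarrow> convergent (\<lambda>n. X n j v))"

text \<open>The recursion runs over the number of days still to come; with \<open>Suc d\<close> days
  left, the next report is that of day \<open>k - d\<close>. Quantifying day by day instead of over
  the product of the remaining days makes \<open>good_step\<close> valid at every single history,
  not just at almost every one.\<close>

primrec good_rec :: "nat \<Rightarrow> (nat \<Rightarrow> real) \<Rightarrow> bool" where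
  "good_rec 0 v \<longleftrightarrow> (\<forall>j\<le>k. conv j (restrict v {1..j}))"
| "good_rec (Suc d) v \<longleftrightarrow> (AE y in Q (k - d). good_rec d (v(k - d := y)))"

text \<open>A history of length \<open>i\<close> is good if almost all of its continuations are points of
  convergence.\<close>

definition good :: "nat \<Rightarrow> (nat \<Rightarrow> real) \<Rightarrow> bool" where
  "good i = good_rec (k - i)"

lemma good_k: "good k v \<longleftrightarrow> (\<forall>j\<le>k. conv j (restrict v {1..j}))"
  by (simp add: good_def)

lemma good_step: "i < k \<Longrightarrow> good i v \<longleftrightarrow> (AE y in Q (Suc i). good (Suc i) (v(Suc i := y)))"
proof -
  assume i: "i < k"
  then have *: "k - i = Suc (k - Suc i)" "k - (k - Suc i) = Suc i" by auto
  show ?thesis unfolding good_def *(1) good_rec.simps *(2) ..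
qed

text \<open>An almost sure property of a probability space has a witness. Hence a good history has a
  continuation that converges on all days, and the two share their initial segments.\<close>

lemma good_imp_conv:
  assumes "i \<le> k" "good i v" "j \<le> i"
  shows "conv j (restrict v {1..j})"
  using assms
proof (induction arbitrary: v rule: inc_induct)
  case base
  then show ?case unfolding good_k by blast
next
  case (step i)
  interpret prob_space "Q (Suc i)" by (rule prob_Q)
  have "AE y in Q (Suc i). good (Suc i) (v(Suc i := y))"
    using step by (simp add: good_step)
  then have "\<exists>y. good (Suc i) (v(Suc i := y))"
    by (rule eventually_happens'[OF ae_filter_bot])
  then obtain y where y: "good (Suc i) (v(Suc i := y))" ..
  have "conv j (restrict (v(Suc i := y)) {1..j})"
    by (rule step.IH[OF y le_SucI[OF step.prems(2)]])
  then show ?case unfolding restrict_upd_le[OF step.prems(2)] .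
qed

section \<open>Measurability and full measure of the good histories\<close>

lemma sets_PiM_Q: "sets (Pi\<^sub>M {1..i} Q) = sets (H i)"
  unfolding profile_distr_def by (intro sets_PiM_cong) (simp_all add: sets_D sets_Q)

lemma pred_convergent:
  fixes f :: "nat \<Rightarrow> 'b \<Rightarrow> real"
  assumes "\<And>n. f n \<in> borel_measurable M"
  shows "Measurable.pred M (\<lambda>x. convergent (\<lambda>n. f n x))"
  unfolding pred_def Cauchy_convergent_iff[symmetric] using assms by (rule sets_Collect_Cauchy)

lemma pred_conv: "j \<le> k \<Longrightarrow> Measurable.pred (H j) (conv j)"
proof (cases "1 \<le> j")
  case True
  moreover assume "j \<le> k"
  ultimately have "conv j = (\<lambda>v. convergent (\<lambda>n. V n j v) \<and> convergent (\<lambda>n. X n j v))"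
    "j \<in> {1..k}" by (auto simp: conv_def)
  then show ?thesis
    using pred_convergent[OF admissibleD(1)[OF adm]] pred_convergent[OF admissibleD(3)[OF adm]]
    by (simp add: pred_intros_logic)
next
  case False
  assume "j \<le> k"
  have "conv j = (\<lambda>v. convergent (\<lambda>n. V n j v))" using False by (auto simp: conv_def)
  then show ?thesis using pred_convergent[OF admissibleD(3)[OF adm \<open>j \<le> k\<close>]] by simp
qed

lemma pred_good:
  assumes "i \<le> k"
  shows "Measurable.pred (H i) (good i)"
  using assms
proof (induction rule: inc_induct)
  case base
  have "Measurable.pred (H k) (\<lambda>v. \<forall>j\<in>{..k}. conv j (restrict v {1..j}))"
    using measurable_compose[OF measurable_restrict_H pred_conv]
    by (intro pred_intros_finite) auto
  moreover have "good k = (\<lambda>v. \<forall>j\<in>{..k}. conv j (restrict v {1..j}))"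
    unfolding fun_eq_iff good_k by blast
  ultimately show ?case by (simp only:)
next
  case (step i)
  interpret prob_space "Q (Suc i)" by (rule prob_Q)
  have "(\<lambda>(v, y). v(Suc i := y)) \<in> H i \<Otimes>\<^sub>M Q (Suc i) \<rightarrow>\<^sub>M H (Suc i)"
  proof -
    have eq: "sets (H i \<Otimes>\<^sub>M Q (Suc i)) = sets (H i \<Otimes>\<^sub>M D (Suc i))"
      by (intro sets_pair_measure_cong refl) (simp add: sets_D sets_Q)
    show ?thesis unfolding measurable_cong_sets[OF eq refl] by (rule measurable_upd)
  qed
  from measurable_compose[OF this step.IH]
  have "Measurable.pred (H i \<Otimes>\<^sub>M Q (Suc i)) (\<lambda>(v, y). good (Suc i) (v(Suc i := y)))"
    by (simp only: case_prod_beta')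
  from measurable_pred_AE[OF this] show ?case
    unfolding good_step[OF step.hyps(2), symmetric] .
qed

lemma AE_Q_good:
  assumes "i \<le> k"
  shows "AE v in Pi\<^sub>M {1..i} Q. good i v"
  using assms
proof (induction rule: inc_induct)
  case base
  show ?case using AE_convergent by (simp add: good_k conv_def)
next
  case (step i)
  have "Measurable.pred (Pi\<^sub>M {1..Suc i} Q) (good (Suc i))"
    unfolding measurable_cong_sets[OF sets_PiM_Q refl] using step.hyps by (intro pred_good) simp
  from AE_PiM_atLeastAtMost_Suc_iff[OF prob_Q this] show ?case
    using step by (simp add: good_step)
qed

text \<open>The empty history is the only point of a probability space, so holding almost everywhere
  means holding there.\<close>

lemma good_root: "good 0 root"
proof -
  have "{1..0::nat} = {}" by simp
  from AE_Q_good[OF le0, unfolded this] have "AE v in Pi\<^sub>M {} Q. good 0 v" .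
  moreover have "AE v in Pi\<^sub>M {} Q. v = root"
    by (rule AE_I2) (simp add: space_PiM)
  ultimately have "AE v in Pi\<^sub>M {} Q. good 0 root" by eventually_elim simp
  moreover interpret prob_space "Pi\<^sub>M {} Q" by (intro prob_space_PiM prob_Q)
  show ?thesis using calculation by simp
qed

definition good_path :: "nat \<Rightarrow> (nat \<Rightarrow> real) \<Rightarrow> bool" where
  "good_path i v \<longleftrightarrow> (\<forall>j\<le>i. good j (restrict v {1..j}))"

lemma good_path_0: "good_path 0 v"
  using good_root by (simp add: good_path_def restrict_def)

lemma good_path_restrict: "good_path i v \<Longrightarrow> j \<le> i \<Longrightarrow> good_path j (restrict v {1..j})"
  by (simp add: good_path_def min_def)

lemma good_path_good: "good_path i v \<Longrightarrow> v \<in> space (H i) \<Longrightarrow> good i v"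
  by (metis good_path_def order_refl restrict_H)

lemma good_path_upd:
  assumes "v \<in> space (H i)" "y \<in> space (D (Suc i))"
  shows "good_path (Suc i) (v(Suc i := y)) \<longleftrightarrow> good_path i v \<and> good (Suc i) (v(Suc i := y))"
proof -
  have split: "(\<forall>j\<le>Suc i. R j) \<longleftrightarrow> (\<forall>j\<le>i. R j) \<and> R (Suc i)" for R
    by (auto simp: le_Suc_eq)
  have old: "(\<forall>j\<le>i. good j (restrict (v(Suc i := y)) {1..j})) \<longleftrightarrow> (\<forall>j\<le>i. good j (restrict v {1..j}))"
    by (intro all_cong) (simp only: restrict_upd_le)
  show ?thesis unfolding good_path_def split old restrict_H[OF upd_in_H[OF assms]] ..
qed

lemma AE_Q_good_path:
  assumes i: "i < k" and v: "v \<in> space (H i)" and g: "good_path i v"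
  shows "AE y in Q (Suc i). good_path (Suc i) (v(Suc i := y))"
proof -
  have "AE y in Q (Suc i). good (Suc i) (v(Suc i := y))"
    using good_path_good[OF g v] i by (simp add: good_step)
  moreover have "AE y in Q (Suc i). y \<in> space (Q (Suc i))" by (rule AE_space)
  ultimately show ?thesis
  proof eventually_elim
    case (elim y)
    then have "y \<in> space (D (Suc i))" by (simp add: space_D space_Q)
    from good_path_upd[OF v this] show ?case using elim g by simp
  qed
qed

lemma pred_good_path:
  assumes "i \<le> k"
  shows "Measurable.pred (H i) (good_path i)"
proof -
  have "Measurable.pred (H i) (\<lambda>v. \<forall>j\<in>{..i}. good j (restrict v {1..j}))"
    using measurable_compose[OF measurable_restrict_H pred_good] assms
    by (intro pred_intros_finite) auto
  moreover have "good_path i = (\<lambda>v. \<forall>j\<in>{..i}. good j (restrict v {1..j}))"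
    unfolding fun_eq_iff good_path_def by blast
  ultimately show ?thesis by (simp only:)
qed

text \<open>After a good path the bad reports of the next day are \<open>Q\<close>-null and
  therefore \<open>D\<close>-null; Fubini collects these exceptions by forward induction.\<close>

lemma AE_good_path: "i \<le> k \<Longrightarrow> AE v in H i. good_path i v"
proof (induction i)
  case 0
  then show ?case by (simp add: good_path_0)
next
  case (Suc i)
  have IH: "AE v in Pi\<^sub>M {1..i} D. good_path i v" using Suc.IH[OF Suc_leD[OF Suc.prems]] unfolding profile_distr_def .
  have "AE v in Pi\<^sub>M {1..i} D. AE y in D (Suc i). good_path (Suc i) (v(Suc i := y))"
    using IH AE_space
  proof eventually_elim
    case (elim v)
    then show ?case using Suc.prems by (intro AE_Q_D AE_Q_good_path) (auto simp: profile_distr_def)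
  qed
  moreover have "Measurable.pred (Pi\<^sub>M {1..Suc i} D) (good_path (Suc i))"
    using pred_good_path[OF Suc.prems] by (simp add: profile_distr_def)
  ultimately show ?case
    unfolding profile_distr_def by (subst AE_PiM_atLeastAtMost_Suc_iff[OF prob_D])
qed

section \<open>Convergence of the utilities at every report after a good path\<close>

lemma V_Lipschitz:
  assumes i: "i < k" and v: "v \<in> space (H i)" and y: "y \<in> space (D (Suc i))" "y' \<in> space (D (Suc i))"
  shows "\<bar>V n (Suc i) (v(Suc i := y)) - V n (Suc i) (v(Suc i := y'))\<bar> \<le> \<bar>y - y'\<bar>"
proof -
  have one: "V n (Suc i) (v(Suc i := a)) - V n (Suc i) (v(Suc i := b)) \<le> \<bar>a - b\<bar>"
    if "a \<in> space (D (Suc i))" "b \<in> space (D (Suc i))" for a b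
  proof -
    have x: "0 \<le> X n (Suc i) (v(Suc i := a))" "X n (Suc i) (v(Suc i := a)) \<le> 1"
      using admissibleD(2)[OF adm, of "Suc i" "v(Suc i := a)"] upd_in_H[OF v that(1)] i by auto
    have "V n (Suc i) (v(Suc i := a)) - V n (Suc i) (v(Suc i := b)) \<le> (a - b) * X n (Suc i) (v(Suc i := a))"
      using admissibleD(7)[OF adm i v that(2) that(1), of n] by (simp add: algebra_simps)
    also have "\<dots> \<le> \<bar>a - b\<bar> * X n (Suc i) (v(Suc i := a))"
      using x by (intro mult_right_mono) auto
    also have "\<dots> \<le> \<bar>a - b\<bar>" using x by (intro mult_left_le) auto
    finally show ?thesis .
  qed
  show ?thesis using one[OF y] one[OF y(2,1)] by linarith
qed

text \<open>Reports that extend the good path have full \<open>Q\<close>-measure, hence are dense,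
  and the utilities converge there. The common Lipschitz bound extends convergence to all reports of
  the day, good or bad.\<close>

lemma V_convergent:
  assumes i: "i < k" and v: "v \<in> space (H i)" and g: "good_path i v" and y: "y \<in> space (D (Suc i))"
  shows "convergent (\<lambda>n. V n (Suc i) (v(Suc i := y)))"
proof (rule convergent_of_dense_equi_Lipschitz[where S = "space (D (Suc i))" and u = "\<lambda>n y. V n (Suc i) (v(Suc i := y))"])
  fix e :: real assume e: "e > 0"
  \<comment> \<open>Clipping to the value interval keeps the window inside it, and nondegenerate,
    even when \<open>y\<close> is an endpoint.\<close>
  let ?a = "max (lo (Suc i)) (y - e)" and ?b = "min (hi (Suc i)) (y + e)"
  have "?a < ?b" using y e lo_less_hi[of "Suc i"] by (auto simp: space_D)
  then obtain s where s: "?a < s" "s < ?b" "good_path (Suc i) (v(Suc i := s))"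
    using dense_Q[OF _ _ _ AE_Q_good_path[OF i v g], of ?a ?b] by auto
  have sD: "s \<in> space (D (Suc i))" using s by (simp add: space_D)
  have "good (Suc i) (v(Suc i := s))" using s(3) good_path_upd[OF v sD] by simp
  then have "conv (Suc i) (v(Suc i := s))"
    using good_imp_conv[of "Suc i" _ "Suc i"] i restrict_H[OF upd_in_H[OF v sD]] by fastforce
  then show "\<exists>s\<in>space (D (Suc i)). \<bar>s - y\<bar> < e \<and> convergent (\<lambda>n. V n (Suc i) (v(Suc i := s)))"
    using s sD by (intro bexI[of _ s]) (auto simp: conv_def)
qed (use V_Lipschitz[OF i v] y in auto)

text \<open>Along good paths we take limits. The first bad report is still treated by the limit, which
  exists everywhere by equicontinuity; from then on nothing is sold and the promised utility is
  frozen.\<close>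

primrec U_lim :: "nat \<Rightarrow> (nat \<Rightarrow> real) \<Rightarrow> real" where
  "U_lim 0 v = lim (\<lambda>n. V n 0 v)"
| "U_lim (Suc i) v = (if good_path i (restrict v {1..i}) then lim (\<lambda>n. V n (Suc i) v)
     else U_lim i (restrict v {1..i}))"

definition x_lim :: "nat \<Rightarrow> (nat \<Rightarrow> real) \<Rightarrow> real" where
  "x_lim i v = (if good_path (i - 1) (restrict v {1..i - 1}) then real_liminf (\<lambda>n. X n i v) else 0)"

lemma U_lim_upd_tendsto:
  assumes "i < k" "v \<in> space (H i)" "good_path i v" "y \<in> space (D (Suc i))"
  shows "(\<lambda>n. V n (Suc i) (v(Suc i := y))) \<longlonglongrightarrow> U_lim (Suc i) (v(Suc i := y))"
  using V_convergent[OF assms] assms by (simp add: convergent_LIMSEQ_iff restrict_upd_H restrict_H del: One_nat_def)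

lemma U_lim_upd_bad:
  "v \<in> space (H i) \<Longrightarrow> \<not> good_path i v \<Longrightarrow> U_lim (Suc i) (v(Suc i := y)) = U_lim i v"
  by (simp add: restrict_upd_H restrict_H del: One_nat_def)

lemma U_lim_root: "(\<lambda>n. V n 0 root) \<longlonglongrightarrow> U_lim 0 root"
proof -
  have "conv 0 (restrict root {1..0})" using good_imp_conv[of 0 root 0] good_root by simp
  then show ?thesis by (simp add: conv_def convergent_LIMSEQ_iff restrict_def)
qed

lemma U_lim_tendsto:
  assumes "i \<le> k" "v \<in> space (H i)" "good_path i v"
  shows "(\<lambda>n. V n i v) \<longlonglongrightarrow> U_lim i v"
proof (cases i)
  case 0
  then show ?thesis using U_lim_root assms(2) by (simp add: space_H)
next
  case (Suc l)
  have h: "restrict v {1..l} \<in> space (H l)" using assms(2) Suc by (intro restrict_in_H) auto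
  have "good_path l (restrict v {1..l})" using good_path_restrict[OF assms(3)] Suc by simp
  then show ?thesis
    using U_lim_upd_tendsto[OF _ h _ last_in_D, of v] assms Suc split_H[of v l] by simp
qed

lemma x_lim_upd:
  assumes "v \<in> space (H i)"
  shows "x_lim (Suc i) (v(Suc i := y)) = (if good_path i v then real_liminf (\<lambda>n. X n (Suc i) (v(Suc i := y))) else 0)"
  using assms by (simp add: x_lim_def restrict_upd_H restrict_H del: One_nat_def)

lemma x_lim_cluster:
  assumes "i \<in> {1..k}" "v \<in> space (H i)"
  shows "\<exists>r. strict_mono r \<and> (\<lambda>n. X (r n) i v) \<longlonglongrightarrow> real_liminf (\<lambda>n. X n i v)"
proof -
  have "0 \<le> X n i v" "X n i v \<le> 1" for n using admissibleD(2)[OF adm assms] by auto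
  then show ?thesis by (rule real_liminf_cluster[of "\<lambda>n. X n i v" 1]) blast
qed

lemma x_lim_range:
  assumes "i \<in> {1..k}" "v \<in> space (H i)"
  shows "0 \<le> x_lim i v \<and> x_lim i v \<le> 1"
proof -
  obtain r where r: "(\<lambda>n. X (r n) i v) \<longlonglongrightarrow> real_liminf (\<lambda>n. X n i v)"
    using x_lim_cluster[OF assms] by blast
  have "0 \<le> real_liminf (\<lambda>n. X n i v)" "real_liminf (\<lambda>n. X n i v) \<le> 1"
    using admissibleD(2)[OF adm assms] by (auto intro: LIMSEQ_le_const[OF r] LIMSEQ_le_const2[OF r])
  then show ?thesis by (simp add: x_lim_def)
qed

lemma x_lim_measurable:
  assumes "i \<in> {1..k}"
  shows "x_lim i \<in> borel_measurable (H i)"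
proof -
  have "Measurable.pred (H i) (\<lambda>v. good_path (i - 1) (restrict v {1..i - 1}))"
    using assms by (intro measurable_compose[OF measurable_restrict_H pred_good_path]) auto
  moreover have "(\<lambda>v. real_liminf (\<lambda>n. X n i v)) \<in> borel_measurable (H i)"
    by (intro borel_measurable_real_liminf admissibleD(1)[OF adm assms])
  ultimately show ?thesis unfolding x_lim_def[abs_def] by (intro measurable_If) (auto simp: pred_def)
qed

lemma U_lim_measurable: "i \<le> k \<Longrightarrow> U_lim i \<in> borel_measurable (H i)"
proof (induction i)
  case 0
  have "(\<lambda>v. lim (\<lambda>n. V n 0 v)) \<in> borel_measurable (H 0)"
    by (intro borel_measurable_lim_metric admissibleD(3)[OF adm 0])
  then show ?case by simp
next
  case (Suc i)
  have "Measurable.pred (H (Suc i)) (\<lambda>v. good_path i (restrict v {1..i}))"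
    using Suc.prems by (intro measurable_compose[OF measurable_restrict_H pred_good_path]) auto
  moreover have "(\<lambda>v. lim (\<lambda>n. V n (Suc i) v)) \<in> borel_measurable (H (Suc i))"
    by (intro borel_measurable_lim_metric admissibleD(3)[OF adm Suc.prems])
  moreover have "(\<lambda>v. U_lim i (restrict v {1..i})) \<in> borel_measurable (H (Suc i))"
    using Suc by (intro measurable_compose[OF measurable_restrict_H]) auto
  ultimately have "(\<lambda>v. if good_path i (restrict v {1..i}) then lim (\<lambda>n. V n (Suc i) v)
     else U_lim i (restrict v {1..i})) \<in> borel_measurable (H (Suc i))"
    by (intro measurable_If) (auto simp: pred_def)
  then show ?case by (simp del: One_nat_def)
qed

lemma U_lim_nonneg: "i \<le> k \<Longrightarrow> v \<in> space (H i) \<Longrightarrow> 0 \<le> U_lim i v"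
proof (induction i arbitrary: v)
  case 0
  have "v = root" using 0 by (simp add: space_H)
  then show ?case
    using U_lim_root admissibleD(4)[OF adm _ root_in_H] by (auto intro: LIMSEQ_le_const)
next
  case (Suc i)
  let ?h = "restrict v {1..i}"
  have h: "?h \<in> space (H i)" using Suc.prems by (intro restrict_in_H) auto
  have y: "v (Suc i) \<in> space (D (Suc i))" using last_in_D Suc.prems by blast
  have "0 \<le> U_lim (Suc i) (?h(Suc i := v (Suc i)))"
  proof (cases "good_path i ?h")
    case True
    have "0 \<le> V n (Suc i) (?h(Suc i := v (Suc i)))" for n
      using admissibleD(4)[OF adm Suc.prems(1) upd_in_H[OF h y]] .
    then show ?thesis
      using U_lim_upd_tendsto[OF _ h True y] Suc.prems by (intro LIMSEQ_le_const) auto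
  next
    case False
    show ?thesis unfolding U_lim_upd_bad[OF h False] by (rule Suc.IH[OF Suc_leD[OF Suc.prems(1)] h])
  qed
  then show ?case unfolding split_H[OF Suc.prems(2)] .
qed

lemma U_lim_integral:
  assumes i: "i < k" and v: "v \<in> space (H i)"
  shows "integrable (D (Suc i)) (\<lambda>y. U_lim (Suc i) (v(Suc i := y)))"
    and "U_lim i v = (\<integral>y. U_lim (Suc i) (v(Suc i := y)) \<partial>D (Suc i))"
proof -
  interpret prob_space "D (Suc i)" by (rule prob_D)
  have "integrable (D (Suc i)) (\<lambda>y. U_lim (Suc i) (v(Suc i := y))) \<and>
      U_lim i v = (\<integral>y. U_lim (Suc i) (v(Suc i := y)) \<partial>D (Suc i))"
  proof (cases "good_path i v")
    case True
    have Um: "(\<lambda>y. U_lim (Suc i) (v(Suc i := y))) \<in> borel_measurable (D (Suc i))"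
      using i by (intro measurable_compose[OF measurable_upd_right[OF v] U_lim_measurable]) auto
    have Vm: "(\<lambda>y. V n (Suc i) (v(Suc i := y))) \<in> borel_measurable (D (Suc i))" for n
      using i by (intro measurable_compose[OF measurable_upd_right[OF v] admissibleD(3)[OF adm]]) auto
    have VB: "norm (V n (Suc i) (v(Suc i := y))) \<le> B" if "y \<in> space (D (Suc i))" for n y
      using V_bound[OF _ upd_in_H[OF v that], of n] admissibleD(4)[OF adm _ upd_in_H[OF v that], of n] i by simp
    have lim: "AE y in D (Suc i). (\<lambda>n. V n (Suc i) (v(Suc i := y))) \<longlonglongrightarrow> U_lim (Suc i) (v(Suc i := y))"
      using U_lim_upd_tendsto[OF i v True] by (intro AE_I2)
    have VB': "AE y in D (Suc i). norm (V n (Suc i) (v(Suc i := y))) \<le> B" for n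
      using VB by (intro AE_I2)
    have Bi: "integrable (D (Suc i)) (\<lambda>_. B)" by simp
    have "(\<lambda>n. \<integral>y. V n (Suc i) (v(Suc i := y)) \<partial>D (Suc i)) \<longlonglongrightarrow> (\<integral>y. U_lim (Suc i) (v(Suc i := y)) \<partial>D (Suc i))"
      by (rule integral_dominated_convergence[OF Um Vm Bi lim VB'])
    moreover have "(\<integral>y. V n (Suc i) (v(Suc i := y)) \<partial>D (Suc i)) = V n i v" for n
      using admissibleD(6)[OF adm i v] by simp
    ultimately have "(\<lambda>n. V n i v) \<longlonglongrightarrow> (\<integral>y. U_lim (Suc i) (v(Suc i := y)) \<partial>D (Suc i))" by simp
    then show ?thesis
      using integrable_dominated_convergence[OF Um Vm Bi lim VB'] U_lim_tendsto[OF _ v True] i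
      by (auto intro: LIMSEQ_unique)
  next
    case False
    then show ?thesis by (simp only: U_lim_upd_bad[OF v] not_False_eq_True) (simp add: prob_space)
  qed
  then show "integrable (D (Suc i)) (\<lambda>y. U_lim (Suc i) (v(Suc i := y)))"
    and "U_lim i v = (\<integral>y. U_lim (Suc i) (v(Suc i := y)) \<partial>D (Suc i))" by auto
qed

text \<open>Only the allocation at \<open>y'\<close> occurs, so one subsequence that realizes its
  limit inferior suffices; the utilities converge along it at both reports. After a bad path the
  inequality compares equal constants.\<close>

lemma U_lim_subgradient:
  assumes i: "i < k" and v: "v \<in> space (H i)" and y: "y \<in> space (D (Suc i))" and y': "y' \<in> space (D (Suc i))"
  shows "U_lim (Suc i) (v(Suc i := y')) + (y - y') * x_lim (Suc i) (v(Suc i := y')) \<le> U_lim (Suc i) (v(Suc i := y))"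
proof (cases "good_path i v")
  case True
  obtain r where r: "strict_mono r"
    "(\<lambda>n. X (r n) (Suc i) (v(Suc i := y'))) \<longlonglongrightarrow> x_lim (Suc i) (v(Suc i := y'))"
    using x_lim_cluster[OF _ upd_in_H[OF v y']] x_lim_upd[OF v] True i by auto
  have U: "(\<lambda>n. V (r n) (Suc i) (v(Suc i := z))) \<longlonglongrightarrow> U_lim (Suc i) (v(Suc i := z))"
    if "z \<in> space (D (Suc i))" for z
    using LIMSEQ_subseq_LIMSEQ[OF U_lim_upd_tendsto[OF i v True that] r(1)] by (simp add: o_def)
  have "(\<lambda>n. V (r n) (Suc i) (v(Suc i := y')) + (y - y') * X (r n) (Suc i) (v(Suc i := y')))
      \<longlonglongrightarrow> U_lim (Suc i) (v(Suc i := y')) + (y - y') * x_lim (Suc i) (v(Suc i := y'))"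
    by (intro tendsto_intros U[OF y'] r(2))
  then show ?thesis
    by (rule LIMSEQ_le[OF _ U[OF y]]) (use admissibleD(7)[OF adm i v y y'] in auto)
next
  case False
  then show ?thesis by (simp add: U_lim_upd_bad[OF v] x_lim_upd[OF v] del: U_lim.simps)
qed

lemma admissible_lim: "admissible x_lim U_lim"
  unfolding admissible_def
  by (intro conjI ballI allI impI)
    (rule x_lim_measurable x_lim_range[THEN conjunct1] x_lim_range[THEN conjunct2] U_lim_measurable
      U_lim_nonneg U_lim_integral U_lim_subgradient; assumption)+

text \<open>On good paths, which have full \<open>D\<close>-measure, the allocations converge and
  \<open>x_lim\<close> is their limit. The sum of the largest values dominates.\<close>

lemma welfare_tendsto: "(\<lambda>n. welfare (X n)) \<longlonglongrightarrow> welfare x_lim"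
  unfolding welfare_def
proof (rule integral_dominated_convergence[where w = "\<lambda>_. \<Sum>j\<in>{1..k}. hi j"])
  interpret prob_space "H k" by (rule prob_space_H)
  have m: "(\<lambda>v. v j * q j (restrict v {1..j})) \<in> borel_measurable (H k)"
    if "admissible q W" "j \<in> {1..k}" for q W j
    by (rule welfare_summand(1)[OF admissibleD(1,2)[OF that(1)] that(2)]) (use that in auto)
  show "(\<lambda>v. \<Sum>j\<in>{1..k}. v j * x_lim j (restrict v {1..j})) \<in> borel_measurable (H k)"
    and "\<And>n. (\<lambda>v. \<Sum>j\<in>{1..k}. v j * X n j (restrict v {1..j})) \<in> borel_measurable (H k)"
    using m[OF admissible_lim] m[OF adm] by (auto intro!: borel_measurable_sum)
  show "integrable (H k) (\<lambda>_. \<Sum>j\<in>{1..k}. hi j)" by simp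
  show "AE v in H k. norm (\<Sum>j\<in>{1..k}. v j * X n j (restrict v {1..j})) \<le> (\<Sum>j\<in>{1..k}. hi j)" for n
  proof (rule AE_I2)
    fix v assume v: "v \<in> space (H k)"
    have "\<bar>v j * X n j (restrict v {1..j})\<bar> \<le> hi j" if "j \<in> {1..k}" for j
      by (rule welfare_summand(2)[OF admissibleD(1,2)[OF adm] that v]) (use that in auto)
    then show "norm (\<Sum>j\<in>{1..k}. v j * X n j (restrict v {1..j})) \<le> (\<Sum>j\<in>{1..k}. hi j)"
      by (intro order_trans[OF norm_sum] sum_mono) auto
  qed
  show "AE v in H k. (\<lambda>n. \<Sum>j\<in>{1..k}. v j * X n j (restrict v {1..j})) \<longlonglongrightarrow> (\<Sum>j\<in>{1..k}. v j * x_lim j (restrict v {1..j}))"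
    using AE_good_path[OF order_refl]
  proof eventually_elim
    case (elim v)
    have "(\<lambda>n. X n j (restrict v {1..j})) \<longlonglongrightarrow> x_lim j (restrict v {1..j})" if j: "j \<in> {1..k}" for j
    proof -
      have "good j (restrict v {1..j})" using elim j by (simp add: good_path_def)
      then have "conv j (restrict v {1..j})"
        using good_imp_conv[of j "restrict v {1..j}" j] j by simp
      then have c: "convergent (\<lambda>n. X n j (restrict v {1..j}))" using j by (simp add: conv_def)
      have "min j (j - 1) = j - 1" by simp
      moreover have "good_path (j - 1) (restrict v {1..j - 1})"
        using elim j by (intro good_path_restrict) auto
      ultimately have "x_lim j (restrict v {1..j}) = real_liminf (\<lambda>n. X n j (restrict v {1..j}))"
        unfolding x_lim_def restrict_restrict by (simp add: Int_absorb1 atLeastatMost_subset_iff)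
      then show ?thesis
        using c real_liminf_eq[of "\<lambda>n. X n j (restrict v {1..j})"] by (auto simp: convergent_def)
    qed
    then show ?case by (intro tendsto_sum tendsto_mult tendsto_const) auto
  qed
qed

lemma objective_tendsto: "(\<lambda>n. objective (X n) (V n)) \<longlonglongrightarrow> objective x_lim U_lim"
  unfolding objective_def by (intro tendsto_diff welfare_tendsto U_lim_root)

end

subsection \<open>Existence of an optimum\<close>

context sequential_sale
begin

section \<open>Convexity of the admissible pairs and existence of a maximizer\<close>

lemma admissible_zero: "admissible (\<lambda>_ _. 0) (\<lambda>_ _. 0)"
  by (simp add: admissible_def)

lemma admissible_mid:
  assumes a: "admissible x U" and b: "admissible x' U'"
  shows "admissible (\<lambda>i v. (x i v + x' i v) / 2) (\<lambda>i v. (U i v + U' i v) / 2)"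
  unfolding admissible_def
proof (intro conjI ballI allI impI)
  fix i v assume iv: "i < k" "v \<in> space (H i)"
  note int = admissibleD(5)[OF a iv] admissibleD(5)[OF b iv]
  then show "integrable (D (Suc i)) (\<lambda>y. (U (Suc i) (v(Suc i := y)) + U' (Suc i) (v(Suc i := y))) / 2)"
    by simp
  show "(U i v + U' i v) / 2 = (\<integral>y. (U (Suc i) (v(Suc i := y)) + U' (Suc i) (v(Suc i := y))) / 2 \<partial>D (Suc i))"
    using int admissibleD(6)[OF a iv] admissibleD(6)[OF b iv] by simp
  fix y y' assume y: "y \<in> space (D (Suc i))" "y' \<in> space (D (Suc i))"
  show "(U (Suc i) (v(Suc i := y')) + U' (Suc i) (v(Suc i := y'))) / 2 +
      (y - y') * ((x (Suc i) (v(Suc i := y')) + x' (Suc i) (v(Suc i := y'))) / 2)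
    \<le> (U (Suc i) (v(Suc i := y)) + U' (Suc i) (v(Suc i := y))) / 2"
  proof -
    have avg: "(s + s') / 2 + t * ((p + p') / 2) \<le> (u + u') / 2"
      if "s + t * p \<le> u" "s' + t * p' \<le> u'" for s s' t p p' u u' :: real
    proof -
      have eq: "(s + s') / 2 + t * ((p + p') / 2) = ((s + t * p) + (s' + t * p')) / 2"
        by (simp add: field_simps)
      show ?thesis unfolding eq by (rule divide_right_mono[OF add_mono[OF that]]) simp
    qed
    show ?thesis by (intro avg admissibleD(7)[OF a iv y] admissibleD(7)[OF b iv y])
  qed
next
  fix i v assume iv: "i \<in> {1..k}" "v \<in> space (H i)"
  show "0 \<le> (x i v + x' i v) / 2" "(x i v + x' i v) / 2 \<le> 1"
    using admissibleD(2)[OF a iv] admissibleD(2)[OF b iv] by auto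
next
  fix i v assume iv: "i \<le> k" "v \<in> space (H i)"
  show "0 \<le> (U i v + U' i v) / 2"
    using admissibleD(4)[OF a iv] admissibleD(4)[OF b iv] by auto
next
  fix i assume "i \<in> {1..k}"
  from admissibleD(1)[OF a this] admissibleD(1)[OF b this]
  show "(\<lambda>v. (x i v + x' i v) / 2) \<in> borel_measurable (H i)" by simp
next
  fix i assume "i \<le> k"
  from admissibleD(3)[OF a this] admissibleD(3)[OF b this]
  show "(\<lambda>v. (U i v + U' i v) / 2) \<in> borel_measurable (H i)" by simp
qed

lemma objective_mid:
  assumes a: "admissible x U" and b: "admissible x' U'"
  shows "objective (\<lambda>i v. (x i v + x' i v) / 2) (\<lambda>i v. (U i v + U' i v) / 2) =
    (objective x U + objective x' U') / 2"
proof -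
  have int: "integrable (H k) (\<lambda>v. \<Sum>j\<in>{1..k}. v j * q j (restrict v {1..j}))"
    if "admissible q W" for q W
  proof (rule Bochner_Integration.integrable_sum)
    fix j assume j: "j \<in> {1..k}"
    show "integrable (H k) (\<lambda>v. v j * q j (restrict v {1..j}))"
      by (rule welfare_summand(3)[OF admissibleD(1,2)[OF that] j]) (use j in auto)
  qed
  have "welfare (\<lambda>i v. (x i v + x' i v) / 2) =
      (\<integral>v. ((\<Sum>j\<in>{1..k}. v j * x j (restrict v {1..j})) + (\<Sum>j\<in>{1..k}. v j * x' j (restrict v {1..j}))) / 2 \<partial>H k)"
    unfolding welfare_def
    by (intro Bochner_Integration.integral_cong refl)
       (simp add: sum.distrib[symmetric] sum_divide_distrib algebra_simps add_divide_distrib)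
  also have "\<dots> = (welfare x + welfare x') / 2"
    unfolding welfare_def using int[OF a] int[OF b] by simp
  finally show ?thesis by (simp add: objective_def field_simps)
qed

lemma measurable_restrict_PiM_Q:
  "g \<in> borel_measurable (H j) \<Longrightarrow> j \<le> k \<Longrightarrow> (\<lambda>v. g (restrict v {1..j})) \<in> borel_measurable (Pi\<^sub>M {1..k} Q)"
proof -
  assume g: "g \<in> borel_measurable (H j)" "j \<le> k"
  have eq: "sets (Pi\<^sub>M {1..k} Q) = sets (H k)"
    unfolding profile_distr_def by (intro sets_PiM_cong) (simp_all add: sets_D sets_Q)
  show ?thesis
    unfolding measurable_cong_sets[OF eq refl] by (rule measurable_compose[OF measurable_restrict_H[OF g(2)] g(1)])
qed

lemma ex_objective_maximizer:
  obtains x U where "admissible x U" and "\<And>x' U'. admissible x' U' \<Longrightarrow> objective x' U' \<le> objective x U"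
proof -
  define A where "A = {m. admissible (fst m) (snd m)}"
  define obj where "obj m = objective (fst m) (snd m)" for m
  define S where "S = (SUP m\<in>A. obj m)"
  have obj_le: "obj m \<le> (\<Sum>j\<in>{1..k}. hi j)" if "m \<in> A" for m
    using that welfare_le admissibleD(4)[OF _ le0 root_in_H] by (fastforce simp: A_def obj_def objective_def)
  have bdd: "bdd_above (obj ` A)" by (rule bdd_aboveI2) (rule obj_le)
  have zero: "((\<lambda>_ _. 0), (\<lambda>_ _. 0)) \<in> A" by (simp add: A_def admissible_zero)
  have S_upper: "obj m \<le> S" if "m \<in> A" for m unfolding S_def by (rule cSUP_upper[OF that bdd])
  have S_nonneg: "0 \<le> S"
    using S_upper[OF zero] by (simp add: obj_def objective_def welfare_def)
  define C where "C n = {m \<in> A. S - 1 / (real n + 1) \<le> obj m}" for n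
  \<comment> \<open>Left components are the allocations, right components the utilities including
    day 0. Reading all of them off full profiles places them on one probability space.\<close>
  define I where "I = Inl ` {1..k} \<union> Inr ` {0..k}"
  define z where "z m i v = (case i of Inl j \<Rightarrow> fst m j (restrict v {1..j}) | Inr j \<Rightarrow> snd m j (restrict v {1..j}))"
    for m :: "(nat \<Rightarrow> (nat \<Rightarrow> real) \<Rightarrow> real) \<times> (nat \<Rightarrow> (nat \<Rightarrow> real) \<Rightarrow> real)" and i v
  \<comment> \<open>Members of \<open>C 0\<close> have objective at least \<open>S - 1\<close>,
    hence at least -1, so \<open>U 0 root\<close> is at most the sum of the \<open>hi j\<close> plus
    1. The growth over the days adds the sum once more. As \<open>B\<close> is at least 1, it bounds
    the allocations too.\<close>
  define B where "B = 2 * (\<Sum>j\<in>{1..k}. hi j) + 1"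
  have hi_sum: "0 \<le> (\<Sum>j\<in>{1..k}. hi j)" using order_trans[OF S_nonneg] cSUP_least[of A obj] obj_le zero
    by (auto simp: S_def)
  have U_B: "snd m j v \<le> B" if m: "m \<in> C 0" and j: "j \<le> k" and v: "v \<in> space (H j)" for m j v
  proof -
    have ad: "admissible (fst m) (snd m)" and "S - 1 \<le> obj m" using m by (auto simp: C_def A_def)
    then have "snd m 0 root \<le> (\<Sum>j\<in>{1..k}. hi j) + 1"
      using welfare_le[OF ad] S_nonneg by (simp add: obj_def objective_def)
    moreover have "(\<Sum>j\<in>{1..j}. hi j) \<le> (\<Sum>j\<in>{1..k}. hi j)"
      using j lo_nonneg lo_less_hi by (intro sum_mono2) (auto intro: less_imp_le le_less_trans)
    ultimately show ?thesis using U_le[OF ad j v] by (simp add: B_def)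
  qed
  have spaceQ: "space (Pi\<^sub>M {1..k} Q) = space (H k)"
    by (simp add: space_PiM space_H space_Q)
  have "prob_space (Pi\<^sub>M {1..k} Q)" by (intro prob_space_PiM prob_Q)
  moreover have "finite I" by (simp add: I_def)
  moreover have "C j \<subseteq> C i" if "i \<le> j" for i j
  proof -
    have "1 / (real j + 1) \<le> 1 / (real i + 1)" using that by (intro divide_left_mono) auto
    then show ?thesis by (auto simp: C_def)
  qed
  moreover have "C n \<noteq> {}" for n
  proof -
    have "S - 1 / (real n + 1) < (SUP m\<in>A. obj m)" by (simp add: S_def)
    then show ?thesis using bdd zero by (subst (asm) less_cSUP_iff) (auto simp: C_def intro: less_imp_le)
  qed
  moreover have "z m i \<in> borel_measurable (Pi\<^sub>M {1..k} Q)" if m: "m \<in> C 0" and i: "i \<in> I" for m i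
  proof -
    have ad: "admissible (fst m) (snd m)" using m by (auto simp: C_def A_def)
    show ?thesis
    proof (cases i)
      case (Inl j)
      then have j: "j \<in> {1..k}" "j \<le> k" using i by (auto simp: I_def)
      from measurable_restrict_PiM_Q[OF admissibleD(1)[OF ad j(1)] j(2)] show ?thesis
        unfolding z_def[abs_def] Inl sum.case .
    next
      case (Inr j)
      then have j: "j \<le> k" using i by (auto simp: I_def)
      from measurable_restrict_PiM_Q[OF admissibleD(3)[OF ad j] j] show ?thesis
        unfolding z_def[abs_def] Inr sum.case .
    qed
  qed
  moreover have "\<bar>z m i v\<bar> \<le> B" if m: "m \<in> C 0" and i: "i \<in> I" and v: "v \<in> space (Pi\<^sub>M {1..k} Q)" for m i v
  proof -
    have ad: "admissible (fst m) (snd m)" using m by (auto simp: C_def A_def)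
    have r: "restrict v {1..j} \<in> space (H j)" if "j \<le> k" for j
      using v that unfolding spaceQ by (rule restrict_in_H)
    show ?thesis
    proof (cases i)
      case (Inl j)
      then have "j \<in> {1..k}" using i by (auto simp: I_def)
      moreover have "1 \<le> B" using hi_sum by (simp add: B_def)
      ultimately show ?thesis using admissibleD(2)[OF ad _ r, of j] Inl by (simp add: z_def)
    next
      case (Inr j)
      then have "j \<le> k" using i by (auto simp: I_def)
      then show ?thesis using U_B[OF m _ r, of j] admissibleD(4)[OF ad _ r, of j] Inr by (simp add: z_def)
    qed
  qed
  moreover have "\<exists>c\<in>C n. \<forall>i\<in>I. \<forall>v\<in>space (Pi\<^sub>M {1..k} Q). z c i v = (z a i v + z b i v) / 2"
    if ab: "a \<in> C n" "b \<in> C n" for n a b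
  proof -
    let ?c = "((\<lambda>i v. (fst a i v + fst b i v) / 2), (\<lambda>i v. (snd a i v + snd b i v) / 2))"
    have ad: "admissible (fst a) (snd a)" "admissible (fst b) (snd b)" using ab by (auto simp: C_def A_def)
    have "?c \<in> A" using admissible_mid[OF ad] by (simp add: A_def)
    moreover have "obj ?c = (obj a + obj b) / 2" using objective_mid[OF ad] by (simp add: obj_def)
    ultimately have "?c \<in> C n" using ab by (simp add: C_def)
    then show ?thesis by (rule bexI[rotated]) (auto simp: z_def I_def)
  qed
  ultimately have "\<exists>m. (\<forall>n::nat. m n \<in> C n) \<and> (AE v in Pi\<^sub>M {1..k} Q. \<forall>i\<in>I. convergent (\<lambda>n. z (m n) i v))"
    by (rule convex_decseq_AE_convergent[of "Pi\<^sub>M {1..k} Q" I C z B])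
  then obtain m where m: "\<And>n::nat. m n \<in> C n"
    and conv: "AE v in Pi\<^sub>M {1..k} Q. \<forall>i\<in>I. convergent (\<lambda>n. z (m n) i v)"
    by blast
  have mA: "m n \<in> A" and m0: "m n \<in> C 0" for n
    using m[of n] S_nonneg
    by (auto simp: C_def intro: order_trans[rotated])
  interpret L: convergent_sales k lo hi D Q "\<lambda>n. fst (m n)" "\<lambda>n. snd (m n)" B
  proof (unfold_locales)
    show "admissible (fst (m n)) (snd (m n))" for n using mA by (simp add: A_def)
    show "snd (m n) i v \<le> B" if "i \<le> k" "v \<in> space (H i)" for n i v
      using U_B[OF m0 that] .
    show "AE v in Pi\<^sub>M {1..k} Q. \<forall>j\<le>k. convergent (\<lambda>n. snd (m n) j (restrict v {1..j})) \<and>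
      (1 \<le> j \<longrightarrow> convergent (\<lambda>n. fst (m n) j (restrict v {1..j})))"
      using conv
    proof eventually_elim
      case (elim v)
      show ?case
      proof (intro allI impI conjI)
        fix j assume "j \<le> k"
        then have "Inr j \<in> I" by (simp add: I_def)
        then show "convergent (\<lambda>n. snd (m n) j (restrict v {1..j}))"
          using elim by (force simp: z_def)
        assume "1 \<le> j"
        then have "Inl j \<in> I" using \<open>j \<le> k\<close> by (simp add: I_def)
        then show "convergent (\<lambda>n. fst (m n) j (restrict v {1..j}))"
          using elim by (force simp: z_def)
      qed
    qed
  qed
  have "S \<le> objective L.x_lim L.U_lim"
  proof (rule LIMSEQ_le[OF _ L.objective_tendsto])
    have "(\<lambda>n. 1 / (real n + 1)) \<longlonglongrightarrow> 0"
      using LIMSEQ_inverse_real_of_nat by (simp add: inverse_eq_divide add.commute)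
    then show "(\<lambda>n. S - 1 / (real n + 1)) \<longlonglongrightarrow> S"
      using tendsto_diff[OF tendsto_const[of S]] by force
    show "\<exists>N. \<forall>n\<ge>N. S - 1 / (real n + 1) \<le> objective (fst (m n)) (snd (m n))"
      using m by (auto simp: C_def obj_def)
  qed
  then show ?thesis
    using that[OF L.admissible_lim] S_upper by (fastforce simp: A_def obj_def)
qed

text \<open>Both translations between mechanisms and pairs turn revenue into objective, so deferring
  the payments of a maximal pair beats every feasible mechanism.\<close>

lemma ex_optimal:
  assumes k: "1 \<le> k"
  shows "\<exists>x p. optimal k D x p \<and> (\<forall>i\<in>{1..<k}. \<forall>v\<in>space (H i). p i v = v i * x i v)"
proof -
  obtain x U where ad: "admissible x U"
    and max: "\<And>x' U'. admissible x' U' \<Longrightarrow> objective x' U' \<le> objective x U"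
    using ex_objective_maximizer by metis
  have "optimal k D x (deferred_payment x U)"
    unfolding optimal_def
  proof (intro conjI allI impI)
    show "feasible k D x (deferred_payment x U)" by (rule feasible_deferred(1)[OF ad k])
    fix x' p' assume f: "feasible k D x' p'"
    show "revenue k D p' \<le> revenue k D (deferred_payment x U)"
      using max[OF admissible_of_feasible(1)[OF f]] admissible_of_feasible(2)[OF f] feasible_deferred(2)[OF ad k]
      by simp
  qed
  then show ?thesis by (intro exI[of _ x] exI[of _ "deferred_payment x U"]) (auto simp: deferred_payment_def)
qed

end

section \<open>Transfer to the given value distributions\<close>

lemma optimal_cong:
  assumes "\<And>j. j \<in> {1..k} \<Longrightarrow> D j = D' j"
  shows "optimal k D x p \<longleftrightarrow> optimal k D' x p"
proof -
  have H: "profile_distr D i = profile_distr D' i" if "i \<le> k" for i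
    unfolding profile_distr_def using assms that by (intro PiM_cong) auto
  have R: "Pi\<^sub>M {i<..k} D = Pi\<^sub>M {i<..k} D'" for i
    using assms by (intro PiM_cong) auto
  have c: "cont_exp k D = cont_exp k D'" by (simp add: cont_exp_def fun_eq_iff R)
  have "mechanism k D x p \<longleftrightarrow> mechanism k D' x p" for x p
    unfolding mechanism_def R using H by (intro conj_cong ball_cong refl) simp_all
  moreover have "periodic_IC k D x p \<longleftrightarrow> periodic_IC k D' x p" for x p
    unfolding periodic_IC_def c using H assms by (intro ball_cong refl) simp_all
  moreover have "ex_post_IR k D x p \<longleftrightarrow> ex_post_IR k D' x p" for x p
    unfolding ex_post_IR_def using H by (intro ball_cong refl) simp_all
  ultimately show ?thesis
    unfolding optimal_def feasible_def revenue_def H[OF order_refl] by simp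
qed

lemma sets_value_distr: "sets (value_distr lo hi f j) = sets (restrict_space borel {lo j..hi j})"
  by (simp add: value_distr_def sets_restrict_space)

lemma prob_space_value_distr:
  assumes f: "f j \<in> borel_measurable (restrict_space lborel {lo j..hi j})"
    and one: "(\<integral>\<^sup>+v\<in>{lo j..hi j}. ennreal (f j v) \<partial>lborel) = 1"
  shows "prob_space (value_distr lo hi f j)"
proof
  let ?R = "restrict_space lborel {lo j..hi j}"
  have "emeasure (value_distr lo hi f j) (space ?R) = (\<integral>\<^sup>+v. ennreal (f j v) * indicator (space ?R) v \<partial>?R)"
    unfolding value_distr_def using f by (intro emeasure_density sets.top) simp
  also have "\<dots> = (\<integral>\<^sup>+v. ennreal (f j v) \<partial>?R)"
    by (intro nn_integral_cong) simp
  also have "\<dots> = (\<integral>\<^sup>+v\<in>{lo j..hi j}. ennreal (f j v) \<partial>lborel)"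
    by (intro nn_integral_restrict_space) simp
  finally show "emeasure (value_distr lo hi f j) (space (value_distr lo hi f j)) = 1"
    by (simp add: one value_distr_def)
qed

lemma AE_value_distr_positive:
  assumes "\<And>v. 0 < f j v" and f: "f j \<in> borel_measurable (restrict_space lborel {lo j..hi j})"
  shows "(AE v in value_distr lo hi f j. P v) \<longleftrightarrow> (AE v in restrict_space lborel {lo j..hi j}. P v)"
  unfolding value_distr_def using assms by (subst AE_density) auto

lemma AE_value_distrI:
  assumes "f j \<in> borel_measurable (restrict_space lborel {lo j..hi j})"
    and "AE v in restrict_space lborel {lo j..hi j}. P v"
  shows "AE v in value_distr lo hi f j. P v"
  unfolding value_distr_def using assms by (subst AE_density) auto

text \<open>A nonempty open interval has positive length, so it cannot consist of exceptional points
  only.\<close>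

lemma AE_restrict_lborel_dense:
  fixes a b l u :: real
  assumes "AE v in restrict_space lborel {l..u}. P v" and "l \<le> a" "a < b" "b \<le> u"
  shows "\<exists>y. a < y \<and> y < b \<and> P y"
proof (rule ccontr)
  assume neg: "\<not> ?thesis"
  have "AE v in lborel. v \<in> {l..u} \<longrightarrow> P v"
    using assms(1) by (subst (asm) AE_restrict_space_iff) auto
  then have "AE v in lborel. v \<notin> {a<..<b}"
  proof eventually_elim
    case (elim v)
    then show ?case using neg assms(2-4) by auto
  qed
  then have "{a<..<b} \<in> null_sets lborel"
    by (subst AE_iff_null_sets) auto
  then show False using assms(3) by (auto simp: null_sets_def)
qed

theorem lemma4:
  fixes k :: nat and lo hi :: "nat \<Rightarrow> real" and f :: "nat \<Rightarrow> real \<Rightarrow> real"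
  assumes "k \<ge> 1"
    and "\<And>j. j \<in> {1..k} \<Longrightarrow> 0 \<le> lo j \<and> lo j < hi j"
    and "\<And>j. j \<in> {1..k} \<Longrightarrow> f j \<in> borel_measurable (restrict_space lborel {lo j..hi j})"
    and "\<And>j v. j \<in> {1..k} \<Longrightarrow> v \<in> {lo j..hi j} \<Longrightarrow> 0 \<le> f j v"
    and "\<And>j. j \<in> {1..k} \<Longrightarrow> (\<integral>\<^sup>+v\<in>{lo j..hi j}. ennreal (f j v) \<partial>lborel) = 1"
  shows "\<exists>x p. optimal k (value_distr lo hi f) x p \<and>
           (\<forall>i\<in>{1..<k}. \<forall>v\<in>space (profile_distr (value_distr lo hi f) i). p i v = v i * x i v)"
proof -
  \<comment> \<open>The locale asks for a distribution on every day, while the assumptions speak of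
    days 1 to \<open>k\<close>; the uniform distribution on [0, 1] fills the other days.\<close>
  define lo' where "lo' j = (if j \<in> {1..k} then lo j else 0)" for j
  define hi' where "hi' j = (if j \<in> {1..k} then hi j else 1)" for j
  define unif :: "nat \<Rightarrow> real \<Rightarrow> real" where "unif j v = 1 / (hi' j - lo' j)" for j v
  define f' where "f' j = (if j \<in> {1..k} then f j else unif j)" for j
  let ?D = "value_distr lo' hi' f'" and ?Q = "value_distr lo' hi' unif"
  have lh: "0 \<le> lo' j" "lo' j < hi' j" for j using assms(2) by (auto simp: lo'_def hi'_def)
  have unif_meas: "unif j \<in> borel_measurable (restrict_space lborel {lo' j..hi' j})" for j
    unfolding unif_def[abs_def] by simp
  have unif_one: "(\<integral>\<^sup>+v\<in>{lo' j..hi' j}. ennreal (unif j v) \<partial>lborel) = 1" for j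
  proof -
    have "(\<integral>\<^sup>+v\<in>{lo' j..hi' j}. ennreal (unif j v) \<partial>lborel) = ennreal (1 / (hi' j - lo' j)) * ennreal (hi' j - lo' j)"
      unfolding unif_def using lh[of j] by (subst nn_integral_cmult_indicator) auto
    also have "\<dots> = 1" using lh[of j] by (simp flip: ennreal_mult')
    finally show ?thesis .
  qed
  have f'_meas: "f' j \<in> borel_measurable (restrict_space lborel {lo' j..hi' j})" for j
    using assms(3)[of j] unif_meas[of j] by (auto simp: f'_def lo'_def hi'_def)
  have f'_one: "(\<integral>\<^sup>+v\<in>{lo' j..hi' j}. ennreal (f' j v) \<partial>lborel) = 1" for j
    using assms(5)[of j] unif_one[of j] by (cases "j \<in> {1..k}") (simp_all add: f'_def lo'_def hi'_def)
  \<comment> \<open>The uniform density is positive, so its null sets are the Lebesgue null sets.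
    Both the absolute continuity of \<open>?D\<close> with respect to \<open>?Q\<close> and the
    density of sets of full \<open>?Q\<close>-measure rest on this.\<close>
  have unif_AE: "(AE v in ?Q j. P v) \<longleftrightarrow> (AE v in restrict_space lborel {lo' j..hi' j}. P v)" for j P
    using lh[of j] by (intro AE_value_distr_positive unif_meas) (simp add: unif_def)
  interpret sequential_sale k lo' hi' ?D ?Q
  proof (rule sequential_sale.intro)
    show "prob_space (?D j)" "prob_space (?Q j)" for j
      by (intro prob_space_value_distr f'_meas f'_one unif_meas unif_one)+
    show "sets (?D j) = sets (restrict_space borel {lo' j..hi' j})"
      "sets (?Q j) = sets (restrict_space borel {lo' j..hi' j})" for j
      by (rule sets_value_distr)+
    show "AE y in ?D j. P y" if "AE y in ?Q j. P y" for j P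
      using that unfolding unif_AE by (rule AE_value_distrI[OF f'_meas])
    show "\<exists>y. a < y \<and> y < b \<and> P y"
      if "lo' j \<le> a" "a < b" "b \<le> hi' j" "AE y in ?Q j. P y" for j P a b
      using that unfolding unif_AE by (intro AE_restrict_lborel_dense)
  qed (rule lh)+
  have D: "?D j = value_distr lo hi f j" if "j \<in> {1..k}" for j
    using that by (simp add: value_distr_def lo'_def hi'_def f'_def)
  have "profile_distr (value_distr lo hi f) i = profile_distr ?D i" if "i \<in> {1..<k}" for i
    unfolding profile_distr_def using that D by (intro PiM_cong) auto
  moreover have "optimal k (value_distr lo hi f) x p \<longleftrightarrow> optimal k ?D x p" for x p
    using D by (intro optimal_cong) simp
  ultimately show ?thesis using ex_optimal[OF assms(1)] by simp
qed

end
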